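(* Let $\mathbb{F}$ be the free group of rank two with free generators $a,b$, and let $f=3-a-b\in\mathbb{Z}\mathbb{F}$. Let $(Y,\sigma,\nu)$ be the full 3-shift action of $\mathbb{F}$ and let $(X_f,\alpha_f,\mu_f)$ be the principal algebraic $\mathbb{F}$-action defined by $f$. Then the homoclinic map $\phi\colon Y\to X_f$ given by $\phi(d)=\pi(d\cdot w^{\Delta})=d\cdot x^{\Delta}$ is continuous, equivariant, surjective, one-to-one off a $\nu$-null set, and satisfies $\phi_*\nu=\mu_f$. Thus $\phi$ is a measurable isomorphism between $(X_f,\alpha_f,\mu_f)$ and a Bernoulli shift.
   Context: $\mathbb{T}=\mathbb{R}/\mathbb{Z}$. Elements $x$ of $\mathbb{T}^{\mathbb{F}}$, $\ell^\infty(\mathbb{F},\mathbb{R})$, $\ell^\infty(\mathbb{F},\mathbb{Z})$, $\ell^1(\mathbb{F},\mathbb{R})$ are written as formal sums $\sum_{t\in\mathbb{F}}x_t\,t$; $\mathbb{F}$ acts by left multiplication, $\sigma^s(x)=s\cdot x$, i.e. $\sigma^s(x)_t=x_{s^{-1}t}$. Right multiplication $x\cdot g$ is defined by formally expanding and collecting terms, $(x\cdot g)_s=\sum_{t\in\mathbb{F}}x_t\,g_{t^{-1}s}$, whenever this makes sense. For $f=\sum_s f_s s\in\mathbb{Z}\mathbb{F}$ put $f^*=\sum_s f_s s^{-1}$. The principal algebraic $\mathbb{F}$-action defined by $f$ is $(X_f,\alpha_f)$, where $X_f=\{x\in\mathbb{T}^{\mathbb{F}}:x\cdot f^*=0\}$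 (the compact Pontryagin dual group of $\mathbb{Z}\mathbb{F}/\mathbb{Z}\mathbb{F}f$), i.e. $x\in X_f$ iff $\sum_s f_s x_{ts}=0$ in $\mathbb{T}$ for every $t\in\mathbb{F}$, and $\alpha_f$ is the restriction of $\sigma$ to $X_f$. $\mu_f$ is normalized Haar measure on $X_f$. For $f=3-a-b$ we have $f^*=3-a^{-1}-b^{-1}$, which is invertible in $\ell^1(\mathbb{F},\mathbb{R})$ with inverse $w^{\Delta}=(f^* )^{-1}=\frac13\sum_{s\in N}3^{-|s|}s$, where $N$ is the set of all words in $a^{-1},b^{-1}$ (including $1_{\mathbb{F}}$) and $|s|$ is word length. Let $\pi\colon\ell^\infty(\mathbb{F},\mathbb{R})\to\mathbb{T}^{\mathbb{F}}$ be coordinatewise reduction mod $1$, and $x^{\Delta}=\pi(w^{\Delta})$. The homoclinic map $\phi\colon\ell^\infty(\mathbb{F},\mathbb{Z})\to\mathbb{T}^{\mathbb{F}}$ is $\phi(d)=\pi(d\cdot w^{\Delta})$, where $(d\cdot w^{\Delta})_s=\sum_t d_t\,w^{\Delta}_{t^{-1}s}$; its image lies in $X_f$. $Y=\{0,1,2\}^{\mathbb{F}}\subset\ell^\infty(\mathbb{F},\mathbb{Z})$ with the product topology, $\nu$ is product measure with each symbol having measure $1/3$, and $(Y,\sigma,\nu)$, with $\sigma^s(d)_t=d_{s^{-1}t}$, is the full 3-shift action. "One-to-one off a $\nu$-null set" means there is $E\subset Y$ with $\nu(E)=0$ such that $\phi$ is one-to-one on $Y\setminus E$. *)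

theory Defs
  imports
    "HOL-Probability.Probability"
    "HOL-Library.Poly_Mapping"
    "HOL-Library.Function_Algebras"
begin

section \<open>The free group of rank two\<close>

text \<open>
  Elements are reduced words in letters \<open>(g, e)\<close>, where \<open>(g, True)\<close> stands for the generator
  \<open>g\<close> and \<open>(g, False)\<close> for its inverse.  The group is written additively because
  \<^class>\<open>group_add\<close> is the type class of (not necessarily commutative) groups: \<open>s + t\<close> is the
  product \<open>st\<close>, \<open>- s\<close> is the inverse of \<open>s\<close> and \<open>0\<close> is the identity.
\<close>

datatype gen = A | B

type_synonym letter = "gen \<times> bool"

definition inv_letter :: "letter \<Rightarrow> letter" where
  "inv_letter l = (fst l, \<not> snd l)"

definition reduced :: "letter list \<Rightarrow> bool" where
  "reduced = successively (\<lambda>k l. l \<noteq> inv_letter k)"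

definition push :: "letter \<Rightarrow> letter list \<Rightarrow> letter list" where
  "push l w = (case w of [] \<Rightarrow> [l] | k # u \<Rightarrow> if k = inv_letter l then u else l # w)"

lemma inv_letter_inv_letter [simp]: "inv_letter (inv_letter l) = l"
  by (simp add: inv_letter_def)

lemma inv_letter_neq [simp]: "inv_letter l \<noteq> l" "l \<noteq> inv_letter l"
  by (auto simp: inv_letter_def prod_eq_iff)

lemma inv_letter_eq_iff [simp]: "inv_letter k = inv_letter l \<longleftrightarrow> k = l"
  by (auto simp: inv_letter_def prod_eq_iff)

lemma reduced_Nil [simp]: "reduced []"
  by (simp add: reduced_def)

lemma reduced_Cons: "reduced (l # w) \<longleftrightarrow> (w = [] \<or> hd w \<noteq> inv_letter l) \<and> reduced w"
  by (auto simp: reduced_def successively_Cons)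

lemma push_Nil [simp]: "push l [] = [l]"
  by (simp add: push_def)

lemma push_Cons: "push l (k # u) = (if k = inv_letter l then u else l # k # u)"
  by (simp add: push_def)

lemma push_reduced: "reduced (l # w) \<Longrightarrow> push l w = l # w"
  by (cases w) (auto simp: push_Cons reduced_Cons)

lemma reduced_push: "reduced w \<Longrightarrow> reduced (push l w)"
  by (cases w) (auto simp: push_Cons reduced_Cons)

lemma push_inv_push: "reduced w \<Longrightarrow> push l (push (inv_letter l) w) = w"
  by (cases w) (auto simp: push_Cons reduced_Cons push_reduced)

lemma reduced_foldr_push: "reduced v \<Longrightarrow> reduced (foldr push u v)"
  by (induction u) (auto intro: reduced_push)

lemma foldr_push_push: "reduced v \<Longrightarrow> foldr push (push l u) v = push l (foldr push u v)"
  by (cases u) (auto simp: push_Cons push_inv_push[symmetric] reduced_foldr_push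
      intro!: push_inv_push[symmetric])

lemma foldr_push_foldr_push:
  "reduced w \<Longrightarrow> foldr push (foldr push u v) w = foldr push u (foldr push v w)"
  by (induction u) (auto simp: foldr_push_push)

lemma foldr_push_reduced_append: "reduced (u @ v) \<Longrightarrow> foldr push u v = u @ v"
proof (induction u)
  case (Cons l u)
  then have "reduced (u @ v)" by (simp add: reduced_Cons)
  with Cons show ?case by (simp add: push_reduced)
qed simp

lemma foldr_push_inverse_left: "foldr push (rev (map inv_letter w)) w = []"
  by (induction w) (auto simp: push_Cons)

lemma reduced_inverse: "reduced (rev (map inv_letter w)) \<longleftrightarrow> reduced w"
  unfolding reduced_def successively_rev successively_map
  by (intro successively_cong) (auto simp: eq_commute)

typedef free2 = "{w. reduced w}"
  morphisms word_of Abs_free2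
  by (rule exI[of _ "[]"]) simp

setup_lifting type_definition_free2

instantiation free2 :: group_add
begin

lift_definition zero_free2 :: free2 is "[]" by simp

lift_definition plus_free2 :: "free2 \<Rightarrow> free2 \<Rightarrow> free2" is "\<lambda>u v. foldr push u v"
  by (rule reduced_foldr_push)

lift_definition uminus_free2 :: "free2 \<Rightarrow> free2" is "\<lambda>w. rev (map inv_letter w)"
  by (simp add: reduced_inverse)

definition minus_free2 :: "free2 \<Rightarrow> free2 \<Rightarrow> free2" where
  "minus_free2 s t = s + - t"

instance
proof
  fix s t u :: free2
  show "s + t + u = s + (t + u)"
    by transfer (rule foldr_push_foldr_push)
  show "0 + s = s"
    by transfer simp
  show "s + 0 = s"
  proof transfer
    fix w assume "reduced w"
    then show "foldr push w [] = w"
      using foldr_push_reduced_append[of w "[]"] by simp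
  qed
  show "- s + s = 0"
    by transfer (rule foldr_push_inverse_left)
  show "s + - t = s - t"
    by (simp add: minus_free2_def)
qed

end

lift_definition gen_a :: free2 is "[(A, True)]" by (simp add: reduced_Cons)
lift_definition gen_b :: free2 is "[(B, True)]" by (simp add: reduced_Cons)

definition word_length :: "free2 \<Rightarrow> nat" where
  "word_length s = length (word_of s)"


lemma word_of_Cons_decomp:
  assumes "word_of s = l # w"
  shows "s = Abs_free2 [l] + Abs_free2 w" "word_of (Abs_free2 w) = w"
proof -
  have red: "reduced (l # w)" using word_of[of s] assms by simp
  then have "reduced w" "reduced [l]" by (simp_all add: reduced_Cons)
  then show "word_of (Abs_free2 w) = w" by (simp add: Abs_free2_inverse)
  have "word_of (Abs_free2 [l] + Abs_free2 w) = word_of s"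
    using \<open>reduced w\<close> \<open>reduced [l]\<close> red assms
    by (simp add: plus_free2.rep_eq Abs_free2_inverse push_reduced)
  then show "s = Abs_free2 [l] + Abs_free2 w"
    by (simp add: word_of_inject)
qed

lemma Abs_free2_letter:
  "Abs_free2 [l] = (let g = (case fst l of A \<Rightarrow> gen_a | B \<Rightarrow> gen_b) in if snd l then g else - g)"
proof -
  have "word_of (Abs_free2 [l]) =
    word_of (let g = (case fst l of A \<Rightarrow> gen_a | B \<Rightarrow> gen_b) in if snd l then g else - g)"
    by (cases l) (auto simp: Abs_free2_inverse reduced_Cons uminus_free2.rep_eq gen_a.rep_eq
      gen_b.rep_eq inv_letter_def Let_def split: gen.split)
  then show ?thesis by (simp only: word_of_inject)
qed

lemma free2_universal:
  fixes x y :: "'g :: group_add"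
  shows "\<exists>!h :: free2 \<Rightarrow> 'g. (\<forall>s t. h (s + t) = h s + h t) \<and> h gen_a = x \<and> h gen_b = y"
proof -
  define val where
    "val l = (let g = (case fst l of A \<Rightarrow> x | B \<Rightarrow> y) in if snd l then g else - g)" for l :: letter
  define ev where "ev w = foldr (\<lambda>l z. val l + z) w 0" for w
  have val_inv: "val (inv_letter l) = - val l" for l
    by (simp add: val_def inv_letter_def Let_def)
  have ev_Cons [simp]: "ev (l # w) = val l + ev w" and ev_Nil [simp]: "ev [] = 0" for l w
    by (simp_all add: ev_def)
  have ev_push: "ev (push l w) = val l + ev w" for l w
    by (cases w) (auto simp: push_Cons val_inv add.assoc[symmetric])
  have ev_foldr: "ev (foldr push u v) = ev u + ev v" for u v
    by (induction u) (simp_all add: ev_push add.assoc)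
  show ?thesis
  proof (rule ex1I)
    show "(\<forall>s t. ev (word_of (s + t)) = ev (word_of s) + ev (word_of t)) \<and>
        ev (word_of gen_a) = x \<and> ev (word_of gen_b) = y"
      by (simp add: plus_free2.rep_eq ev_foldr gen_a.rep_eq gen_b.rep_eq val_def)
  next
    fix h :: "free2 \<Rightarrow> 'g"
    assume h: "(\<forall>s t. h (s + t) = h s + h t) \<and> h gen_a = x \<and> h gen_b = y"
    then have h_add: "h (s + t) = h s + h t" for s t by blast
    have h0: "h 0 = 0"
      using h_add[of 0 0] add_left_cancel[of "h 0" "h 0" 0] by simp
    have hm: "h (- s) = - h s" for s
      using h_add[of "- s" s] by (simp add: h0 eq_neg_iff_add_eq_0)
    have hl: "h (Abs_free2 [l]) = val l" for l
      using h by (auto simp: Abs_free2_letter val_def Let_def hm split: gen.split)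
    have "word_of s = w \<Longrightarrow> h s = ev w" for s w
    proof (induction w arbitrary: s)
      case Nil
      then have "s = 0" by (metis word_of_inject zero_free2.rep_eq)
      then show ?case by (simp add: h0)
    next
      case (Cons l w)
      from word_of_Cons_decomp[OF Cons.prems] Cons.IH[of "Abs_free2 w"] h hl
      show ?case by simp
    qed
    then show "h = (\<lambda>s. ev (word_of s))" by auto
  qed
qed


section \<open>The circle group\<close>

quotient_type circle = real / "\<lambda>x y :: real. x - y \<in> \<int>"
proof (rule equivpI)
  show "reflp (\<lambda>x y :: real. x - y \<in> \<int>)" by (simp add: reflp_def)
  show "symp (\<lambda>x y :: real. x - y \<in> \<int>)"
    by (auto simp: symp_def) (metis Ints_minus minus_diff_eq)
  show "transp (\<lambda>x y :: real. x - y \<in> \<int>)"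
    by (auto simp: transp_def) (metis Ints_add add_diff_eq diff_add_cancel)
qed

lift_definition circle_of :: "real \<Rightarrow> circle" is "\<lambda>x. x" .

instantiation circle :: ab_group_add
begin

lift_definition zero_circle :: circle is 0 .

lift_definition plus_circle :: "circle \<Rightarrow> circle \<Rightarrow> circle" is "(+)"
  by (metis Ints_add add_diff_add)

lift_definition uminus_circle :: "circle \<Rightarrow> circle" is uminus
  by (metis Ints_minus minus_diff_commute minus_diff_eq minus_diff_minus)

lift_definition minus_circle :: "circle \<Rightarrow> circle \<Rightarrow> circle" is "(-)"
  by (smt (verit) Ints_diff)

instance
  by (standard; transfer; simp)

end

lift_definition int_scale :: "int \<Rightarrow> circle \<Rightarrow> circle" is "\<lambda>n x. of_int n * x"
  by (metis Ints_mult Ints_of_int right_diff_distrib)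

instantiation circle :: topological_space
begin

definition open_circle :: "circle set \<Rightarrow> bool" where
  "open_circle U \<longleftrightarrow> open (circle_of -` U)"

instance
proof
  show "open (UNIV :: circle set)" by (simp add: open_circle_def)
  show "open (S \<inter> T)" if "open S" "open T" for S T :: "circle set"
    using that by (simp add: open_circle_def open_Int)
  show "open (\<Union> K)" if "\<forall>S\<in>K. open S" for K :: "circle set set"
    using that by (auto simp: open_circle_def vimage_Union)
qed

end

lift_definition circle_cis :: "circle \<Rightarrow> complex" is "\<lambda>x. cis (2 * pi * x)"
proof -
  fix x y :: real assume "x - y \<in> \<int>"
  then obtain n where "x = y + of_int n" by (metis Ints_cases diff_add_cancel add.commute)
  then show "cis (2 * pi * x) = cis (2 * pi * y)"
    by (simp add: distrib_left cis_mult[symmetric])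
qed

instance circle :: t2_space
proof
  fix x y :: circle assume neq: "x \<noteq> y"
  have open_vim: "open (circle_cis -` V)" if "open V" for V
  proof -
    have "circle_of -` circle_cis -` V = (\<lambda>x. cis (2 * pi * x)) -` V"
      by (auto simp: circle_cis.abs_eq circle_of.abs_eq)
    moreover have "open \<dots>"
      by (intro open_vimage that continuous_intros)
    ultimately show ?thesis by (simp add: open_circle_def)
  qed
  have "circle_cis x \<noteq> circle_cis y"
    using neq
  proof transfer
    fix x y :: real assume "x - y \<notin> \<int>"
    show "cis (2 * pi * x) \<noteq> cis (2 * pi * y)"
    proof
      assume "cis (2 * pi * x) = cis (2 * pi * y)"
      then have "cis (2 * pi * x - 2 * pi * y) = 1"
        by (simp add: cis_divide[symmetric])
      then have "cos (2 * pi * (x - y)) = 1"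
        by (metis cis.simps(1) one_complex.simps(1) right_diff_distrib)
      then obtain n :: int where "2 * pi * (x - y) = of_int n * (2 * pi)"
        by (auto simp: cos_one_2pi_int)
      then have "x - y = of_int n" by simp
      with \<open>x - y \<notin> \<int>\<close> show False by simp
    qed
  qed
  then obtain U V where UV: "open U" "open V" "circle_cis x \<in> U" "circle_cis y \<in> V" "U \<inter> V = {}"
    by (meson separation_t2)
  then show "\<exists>U V. open U \<and> open V \<and> x \<in> U \<and> y \<in> V \<and> U \<inter> V = {}"
    by (intro exI[of _ "circle_cis -` U"] exI[of _ "circle_cis -` V"]) (auto simp: open_vim)
qed


section \<open>Shift and right multiplication\<close>

definition left_shift :: "free2 \<Rightarrow> (free2 \<Rightarrow> 'v) \<Rightarrow> free2 \<Rightarrow> 'v" where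
  "left_shift s x = (\<lambda>t. x (- s + t))"

text \<open>
  The right multiplication \<open>x \<cdot> g\<close> of formal sums, for coefficients paired by \<open>m\<close>.  It is meaningful
  where the family under \<^const>\<open>infsum\<close> is summable (\<^const>\<open>infsum\<close> is \<open>0\<close> otherwise).
\<close>

definition rmul ::
  "('u \<Rightarrow> 'v \<Rightarrow> 'w :: {comm_monoid_add, t2_space}) \<Rightarrow> (free2 \<Rightarrow> 'u) \<Rightarrow> (free2 \<Rightarrow> 'v) \<Rightarrow> free2 \<Rightarrow> 'w" where
  "rmul m x g = (\<lambda>s. \<Sum>\<^sub>\<infinity>t. m (x t) (g (- t + s)))"


section \<open>Principal algebraic actions\<close>

text \<open>The integral group ring of the free group is the ring \<open>free2 \<Rightarrow>\<^sub>0 int\<close>.\<close>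

abbreviation coeff :: "(free2 \<Rightarrow>\<^sub>0 int) \<Rightarrow> free2 \<Rightarrow> int" where
  "coeff \<equiv> Poly_Mapping.lookup"

abbreviation supp :: "(free2 \<Rightarrow>\<^sub>0 int) \<Rightarrow> free2 set" where
  "supp \<equiv> Poly_Mapping.keys"

definition star :: "(free2 \<Rightarrow>\<^sub>0 int) \<Rightarrow> (free2 \<Rightarrow>\<^sub>0 int)" where
  "star f = Poly_Mapping.map_key uminus f"

lemma coeff_star: "coeff (star f) s = coeff f (- s)"
  by (simp add: star_def Poly_Mapping.map_key.rep_eq)

text \<open>
  \<open>X\<^sub>f\<close> carries the subspace topology of the product topology on \<open>free2 \<Rightarrow> circle\<close>; its points are the
  \<open>x\<close> with \<open>x \<cdot> f\<^sup>* = 0\<close>, where \<open>0\<close> is the constant function.  The sum is finite here, see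
  \<open>mem_principal_space_iff\<close>.
\<close>

definition principal_space :: "(free2 \<Rightarrow>\<^sub>0 int) \<Rightarrow> (free2 \<Rightarrow> circle) set" where
  "principal_space f = {x. rmul (\<lambda>u n. int_scale n u) x (coeff (star f)) = 0}"

lemma int_scale_0 [simp]: "int_scale 0 u = 0"
  by transfer simp

lemma mem_principal_space_iff:
  "x \<in> principal_space f \<longleftrightarrow> (\<forall>t. (\<Sum>s\<in>supp f. int_scale (coeff f s) (x (t + s))) = 0)"
proof -
  have "rmul (\<lambda>u n. int_scale n u) x (coeff (star f)) t =
      (\<Sum>s\<in>supp f. int_scale (coeff f s) (x (t + s)))" for t
  proof -
    have "rmul (\<lambda>u n. int_scale n u) x (coeff (star f)) t =
        (\<Sum>\<^sub>\<infinity>r. int_scale (coeff f (- t + r)) (x r))"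
      by (simp add: rmul_def coeff_star minus_add)
    also have "\<dots> = (\<Sum>\<^sub>\<infinity>r\<in>(+) t ` supp f. int_scale (coeff f (- t + r)) (x r))"
    proof (rule infsum_cong_neutral)
      fix r assume "r \<in> UNIV - (+) t ` supp f"
      then have "- t + r \<notin> supp f" by (metis add_minus_cancel image_eqI DiffD2)
      then show "int_scale (coeff f (- t + r)) (x r) = 0" by (simp add: in_keys_iff)
    qed auto
    also have "\<dots> = (\<Sum>s\<in>supp f. int_scale (coeff f s) (x (t + s)))"
      by (simp add: sum.reindex add.assoc[symmetric])
    finally show ?thesis .
  qed
  then show ?thesis
    by (simp add: principal_space_def fun_eq_iff)
qed

definition principal_action ::
  "(free2 \<Rightarrow>\<^sub>0 int) \<Rightarrow> free2 \<Rightarrow> (free2 \<Rightarrow> circle) \<Rightarrow> (free2 \<Rightarrow> circle)" where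
  "principal_action f s = restrict (left_shift s) (principal_space f)"

text \<open>
  Normalized Haar measure of a closed subgroup \<open>K\<close> of \<open>(\<real>/\<int>)\<^sup>F\<close>, on its Borel \<open>\<sigma>\<close>-algebra.  No regularity
  condition is needed: \<open>K\<close> is compact and metrizable because the free group is countable.
\<close>

definition is_normalized_haar :: "(free2 \<Rightarrow> circle) set \<Rightarrow> (free2 \<Rightarrow> circle) measure \<Rightarrow> bool" where
  "is_normalized_haar K M \<longleftrightarrow>
     sets M = sets (restrict_space borel K) \<and> prob_space M \<and>
     (\<forall>x\<in>K. \<forall>E\<in>sets M. emeasure M ((+) x ` E) = emeasure M E)"

definition normalized_haar :: "(free2 \<Rightarrow> circle) set \<Rightarrow> (free2 \<Rightarrow> circle) measure" where
  "normalized_haar K = (THE M. is_normalized_haar K M)"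


section \<open>The homoclinic map\<close>

definition f_ab :: "free2 \<Rightarrow>\<^sub>0 int" where
  "f_ab = 3 - Poly_Mapping.single gen_a 1 - Poly_Mapping.single gen_b 1"

text \<open>
  \<open>neg_words\<close> is the submonoid generated by the inverses of the generators.  \<open>w_delta\<close> is given by
  its closed formula; \<open>w_delta_summable\<close> and \<open>w_delta_inverse\<close> below show that it is the inverse
  of \<open>f\<^sup>*\<close> in \<open>l\<^sup>1\<close>.
\<close>

inductive_set neg_words :: "free2 set" where
  zero: "0 \<in> neg_words"
| minus_a: "s \<in> neg_words \<Longrightarrow> - gen_a + s \<in> neg_words"
| minus_b: "s \<in> neg_words \<Longrightarrow> - gen_b + s \<in> neg_words"

definition w_delta :: "free2 \<Rightarrow> real" where
  "w_delta s = (if s \<in> neg_words then (1/3) * (1/3) ^ word_length s else 0)"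

definition x_delta :: "free2 \<Rightarrow> circle" where
  "x_delta = circle_of \<circ> w_delta"

definition homoclinic_map :: "(free2 \<Rightarrow> int) \<Rightarrow> (free2 \<Rightarrow> circle)" where
  "homoclinic_map d = circle_of \<circ> rmul (\<lambda>n r. of_int n * r) d w_delta"

lemma neg_words_iff: "s \<in> neg_words \<longleftrightarrow> (\<forall>l\<in>set (word_of s). \<not> snd l)"
proof
  assume "s \<in> neg_words"
  then show "\<forall>l\<in>set (word_of s). \<not> snd l"
  proof induction
    case zero
    then show ?case by (simp add: zero_free2.rep_eq)
  next
    case (minus_a s)
    then show ?case
      by (cases "word_of s") (auto simp: plus_free2.rep_eq uminus_free2.rep_eq gen_a.rep_eq push_Cons
          inv_letter_def)
  next
    case (minus_b s)
    then show ?case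
      by (cases "word_of s") (auto simp: plus_free2.rep_eq uminus_free2.rep_eq gen_b.rep_eq push_Cons
          inv_letter_def)
  qed
next
  have "word_of s = w \<Longrightarrow> \<forall>l\<in>set w. \<not> snd l \<Longrightarrow> s \<in> neg_words" for w
  proof (induction w arbitrary: s)
    case Nil
    then have "s = 0" by (metis word_of_inject zero_free2.rep_eq)
    then show ?case by (simp add: neg_words.zero)
  next
    case (Cons l w)
    from word_of_Cons_decomp[OF Cons.prems(1)] Cons.IH[of "Abs_free2 w"] Cons.prems(2)
    show ?case
      by (cases "fst l") (auto simp: Abs_free2_letter intro: neg_words.intros)
  qed
  then show "\<forall>l\<in>set (word_of s). \<not> snd l \<Longrightarrow> s \<in> neg_words" by blast
qed

lemma w_delta_word_of:
  "w_delta s = (if \<forall>l\<in>set (word_of s). \<not> snd l then (1/3) * (1/3) ^ length (word_of s) else 0)"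
  by (simp add: w_delta_def neg_words_iff word_length_def)

lemma w_delta_left:
  "3 * w_delta s - w_delta (gen_a + s) - w_delta (gen_b + s) = indicator {0} s"
proof (cases "word_of s")
  case Nil
  then have "s = 0" by (metis word_of_inject zero_free2.rep_eq)
  then show ?thesis
    by (simp add: w_delta_word_of zero_free2.rep_eq gen_a.rep_eq gen_b.rep_eq)
next
  case (Cons l u)
  then have "s \<noteq> 0" by (auto simp: zero_free2.rep_eq)
  moreover obtain g e where "l = (g, e)" by (cases l)
  ultimately show ?thesis using Cons
    by (cases g; cases e) (auto simp: w_delta_word_of plus_free2.rep_eq gen_a.rep_eq gen_b.rep_eq
      push_Cons inv_letter_def)
qed

lemma w_delta_right:
  "3 * w_delta s - w_delta (s + gen_a) - w_delta (s + gen_b) = indicator {0} s"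
proof (cases "word_of s" rule: rev_cases)
  case Nil
  then have "s = 0" by (metis word_of_inject zero_free2.rep_eq)
  then show ?thesis
    by (simp add: w_delta_word_of zero_free2.rep_eq gen_a.rep_eq gen_b.rep_eq)
next
  case (snoc u l)
  then have "s \<noteq> 0" by (auto simp: zero_free2.rep_eq)
  have red: "reduced (u @ [l])" using word_of[of s] snoc by simp
  have *: "foldr push (u @ [l]) [k] = (if k = inv_letter l then u else u @ [l, k])" for k
  proof -
    have "reduced u" using red by (simp add: reduced_def successively_append_iff)
    then have "foldr push u [] = u"
      using foldr_push_reduced_append[of u "[]"] by simp
    moreover have "foldr push u [l, k] = u @ [l, k]" if "k \<noteq> inv_letter l"
      using red that
      by (intro foldr_push_reduced_append) (auto simp: reduced_def successively_append_iff)
    ultimately show ?thesis by (auto simp: push_Cons)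
  qed
  obtain g e where l: "l = (g, e)" by (cases l)
  show ?thesis using \<open>s \<noteq> 0\<close> snoc *
    unfolding l by (cases g; cases e) (simp_all add: w_delta_word_of plus_free2.rep_eq
      gen_a.rep_eq gen_b.rep_eq inv_letter_def del: foldr_append)
qed

lemma gens_neq: "gen_a \<noteq> gen_b" "gen_a \<noteq> 0" "gen_b \<noteq> 0" "gen_b \<noteq> gen_a"
  by (simp_all add: word_of_inject[symmetric] gen_a.rep_eq gen_b.rep_eq zero_free2.rep_eq)

lemma coeff_star_f_ab:
  "coeff (star f_ab) s = (if s = 0 then 3 else if s = - gen_a \<or> s = - gen_b then - 1 else 0)"
  using gens_neq
  by (auto simp: coeff_star f_ab_def lookup_minus lookup_single lookup_numeral when_def
      minus_equation_iff[of s gen_a] minus_equation_iff[of s gen_b])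

lemma w_delta_inverse:
  "rmul (*) (\<lambda>s. real_of_int (coeff (star f_ab) s)) w_delta = indicator {0}" (is ?left)
  "rmul (*) w_delta (\<lambda>s. real_of_int (coeff (star f_ab) s)) = indicator {0}" (is ?right)
proof -
  show ?left
  proof
    fix s
    have "rmul (*) (\<lambda>s. real_of_int (coeff (star f_ab) s)) w_delta s =
        (\<Sum>\<^sub>\<infinity>t\<in>{0, - gen_a, - gen_b}. real_of_int (coeff (star f_ab) t) * w_delta (- t + s))"
      unfolding rmul_def by (rule infsum_cong_neutral) (auto simp: coeff_star_f_ab)
    also have "\<dots> = 3 * w_delta s - w_delta (gen_a + s) - w_delta (gen_b + s)"
      using gens_neq by (simp add: coeff_star_f_ab)
    finally show "rmul (*) (\<lambda>s. real_of_int (coeff (star f_ab) s)) w_delta s = indicator {0} s"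
      by (simp add: w_delta_left)
  qed
  show ?right
  proof
    fix s
    have cancel: "- (s + t) + s = - t" for t :: free2
      by (simp add: minus_add add.assoc)
    have "t = s + - (- t + s)" for t :: free2
      by (simp add: minus_add add.assoc[symmetric])
    then have eqs: "- t + s = - u \<Longrightarrow> t = s + u" for t u :: free2
      by (metis minus_minus)
    have "rmul (*) w_delta (\<lambda>s. real_of_int (coeff (star f_ab) s)) s =
        (\<Sum>\<^sub>\<infinity>t\<in>{s, s + gen_a, s + gen_b}. w_delta t * real_of_int (coeff (star f_ab) (- t + s)))"
      unfolding rmul_def
      by (rule infsum_cong_neutral) (auto simp: coeff_star_f_ab dest: eqs eqs[of _ 0, simplified])
    also have "\<dots> = 3 * w_delta s - w_delta (s + gen_a) - w_delta (s + gen_b)"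
    proof -
      define G where "G t = w_delta t * real_of_int (coeff (star f_ab) (- t + s))" for t
      have neq: "s + gen_a \<noteq> s" "s + gen_b \<noteq> s" "s + gen_a \<noteq> s + gen_b"
        using gens_neq by (metis add.right_neutral add_left_cancel)+
      have G: "G s = 3 * w_delta s" "G (s + gen_a) = - w_delta (s + gen_a)"
        "G (s + gen_b) = - w_delta (s + gen_b)"
        unfolding G_def cancel using gens_neq by (simp_all add: coeff_star_f_ab)
      have "infsum G {s, s + gen_a, s + gen_b} = G s + (G (s + gen_a) + G (s + gen_b))"
        using neq by (simp del: add_left_cancel)
      then show ?thesis by (simp add: G) (simp add: G_def)
    qed
    finally show "rmul (*) w_delta (\<lambda>s. real_of_int (coeff (star f_ab) s)) s = indicator {0} s"
      by (simp add: w_delta_right)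
  qed
qed

lemma w_delta_summable: "w_delta summable_on UNIV"
proof (rule nonneg_bdd_above_summable_on)
  show "0 \<le> w_delta s" for s by (simp add: w_delta_def)
  show "bdd_above (sum w_delta ` {F. F \<subseteq> UNIV \<and> finite F})"
  proof (rule bdd_aboveI2)
    fix F :: "free2 set" assume "F \<in> {F. F \<subseteq> UNIV \<and> finite F}"
    then have fin: "finite F" by simp
    define c where "c xs = (1/3) * (1/3 :: real) ^ length xs" for xs :: "gen list"
    define q where "q s = map fst (word_of s)" for s
    define n where "n = Suc (Max (insert 0 (length ` q ` F)))"
    have UNIV_gen: "(UNIV :: gen set) = {A, B}" using gen.exhaust by auto
    have fin_gen: "finite (UNIV :: gen set)" by (simp add: UNIV_gen)
    have card_gen: "card (UNIV :: gen set) = 2" by (simp add: UNIV_gen)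
    have len: "finite {xs :: gen list. length xs = k}" "card {xs :: gen list. length xs = k} = 2 ^ k"
      for k
      using finite_lists_length_eq[OF fin_gen, of k] card_lists_length_eq[OF fin_gen, of k]
      by (simp_all add: card_gen)
    have total: "finite {xs :: gen list. length xs < k} \<and> sum c {xs. length xs < k} = 1 - (2/3) ^ k" for k
    proof (induction k)
      case (Suc k)
      have "{xs :: gen list. length xs < Suc k} = {xs. length xs < k} \<union> {xs. length xs = k}"
        by auto
      moreover have "sum c {xs. length xs = k} = 2 ^ k * ((1/3) * (1/3) ^ k)"
        by (simp add: c_def len(2))
      ultimately show ?case using Suc len(1)[of k]
        by (auto simp: sum.union_disjoint[of "{xs :: gen list. length xs < k}"] disjoint_iff
            field_simps power_divide)
    qed simp
    have q_inj: "inj_on q (F \<inter> neg_words)"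
    proof (rule inj_onI)
      fix s t assume st: "s \<in> F \<inter> neg_words" "t \<in> F \<inter> neg_words" "q s = q t"
      have "word_of r = map (\<lambda>g. (g, False)) (q r)" if "r \<in> neg_words" for r
        using that unfolding neg_words_iff q_def map_map o_def
        by (intro map_idI[symmetric]) (auto simp: prod_eq_iff)
      with st have "word_of s = word_of t" by auto
      then show "s = t" by (simp add: word_of_inject)
    qed
    have "sum w_delta F = sum w_delta (F \<inter> neg_words)"
      using fin by (intro sum.mono_neutral_right) (auto simp: w_delta_def)
    also have "\<dots> = sum c (q ` (F \<inter> neg_words))"
      unfolding sum.reindex[OF q_inj]
      by (rule sum.cong) (auto simp: c_def w_delta_def q_def word_length_def)
    also have "\<dots> \<le> sum c {xs. length xs < n}"
    proof (rule sum_mono2)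
      show "q ` (F \<inter> neg_words) \<subseteq> {xs. length xs < n}"
        using fin by (auto simp: n_def less_Suc_eq_le)
    qed (use total[of n] in \<open>auto simp: c_def\<close>)
    also have "\<dots> \<le> 1" using total[of n] by simp
    finally show "sum w_delta F \<le> 1" .
  qed
qed


section \<open>Bernoulli shifts and measurable isomorphism\<close>

definition bernoulli_measure :: "'v measure \<Rightarrow> (free2 \<Rightarrow> 'v) measure" where
  "bernoulli_measure K = PiM UNIV (\<lambda>_. K)"

text \<open>As a subspace of \<open>free2 \<Rightarrow> int\<close>, this carries the product of the discrete topologies.\<close>

definition full_3_shift :: "(free2 \<Rightarrow> int) set" where
  "full_3_shift = {d. \<forall>t. d t \<in> {0, 1, 2}}"

definition full_3_shift_measure :: "(free2 \<Rightarrow> int) measure" where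
  "full_3_shift_measure = bernoulli_measure (uniform_count_measure {0, 1, 2})"

lemma space_full_3_shift_measure: "space full_3_shift_measure = full_3_shift"
  by (auto simp: full_3_shift_measure_def bernoulli_measure_def space_PiM full_3_shift_def
      space_uniform_count_measure PiE_def)

text \<open>
  \<open>\<phi>\<close> is a measurable isomorphism from the action \<open>\<alpha>\<close> on \<open>M\<close> to the action \<open>\<beta>\<close> on \<open>N\<close>: it is
  measure-preserving and restricts to an equivariant bijection with measurable inverse between
  invariant measurable sets of full measure.
\<close>

definition measurable_isomorphism ::
  "'x measure \<Rightarrow> ('g \<Rightarrow> 'x \<Rightarrow> 'x) \<Rightarrow> 'y measure \<Rightarrow> ('g \<Rightarrow> 'y \<Rightarrow> 'y) \<Rightarrow> ('x \<Rightarrow> 'y) \<Rightarrow> bool" where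
  "measurable_isomorphism M \<alpha> N \<beta> \<phi> \<longleftrightarrow>
     \<phi> \<in> measurable M N \<and> distr M N \<phi> = N \<and>
     (\<exists>M\<^sub>0\<in>sets M. \<exists>N\<^sub>0\<in>sets N.
        (AE x in M. x \<in> M\<^sub>0) \<and> (AE y in N. y \<in> N\<^sub>0) \<and>
        (\<forall>g. \<forall>x\<in>M\<^sub>0. \<alpha> g x \<in> M\<^sub>0) \<and> (\<forall>g. \<forall>y\<in>N\<^sub>0. \<beta> g y \<in> N\<^sub>0) \<and>
        (\<forall>g. \<forall>x\<in>M\<^sub>0. \<phi> (\<alpha> g x) = \<beta> g (\<phi> x)) \<and>
        bij_betw \<phi> M\<^sub>0 N\<^sub>0 \<and> the_inv_into M\<^sub>0 \<phi> \<in> measurable (restrict_space N N\<^sub>0) M)"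

end

theory Submission
  imports Defs
begin

text \<open>
  Write \<open>v = d \<cdot> w\<^sup>\<Delta>\<close> for the real lift of \<open>\<phi>(d)\<close>, with \<open>d\<close> in \<open>Y = {0,1,2}\<^sup>F\<close>.  Since \<open>w\<^sup>\<Delta>\<close> inverts
  \<open>f\<^sup>*\<close>, the lift solves \<open>3 v\<^sub>s = d\<^sub>s + v\<^sub>s\<^sub>a + v\<^sub>s\<^sub>b\<close>, and it takes values in \<open>[0, 2]\<close>
  (\<open>real_lift_recursion\<close>, \<open>real_lift_bounds\<close>).  This is a base 3 expansion along the binary
  tree of the descendants \<open>su\<close> of \<open>s\<close>, \<open>u\<close> a word in \<open>a, b\<close>: the dependence on generation \<open>n\<close> is
  of order \<open>(2/3)\<^sup>n\<close>, which gives continuity.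

  Surjectivity and \<open>\<phi>\<^sub>*\<nu> = \<mu>\<^sub>f\<close> come from one construction.  Given \<open>x\<close> in \<open>X\<^sub>f\<close> and \<open>d\<close>, add \<open>x\<close> to
  \<open>\<phi>(d)\<close> by addition with carry: fix arbitrary lifts of \<open>x + \<phi>(d)\<close> on the elements of height \<open>n\<close>, where
  the height is the homomorphism to \<open>\<int>\<close> sending \<open>a, b\<close> to \<open>1\<close>, and move to smaller heights.  Once
  lifts at \<open>sa\<close> and \<open>sb\<close> are chosen, exactly one digit at \<open>s\<close> yields a lift at \<open>s\<close>, and it has the
  form \<open>d\<^sub>s\<close> plus a carry that depends only on digits of greater height.  Such a triangular map
  \<open>T\<^sub>n\<close> preserves \<open>\<nu>\<close> (\<open>distr_twist\<close>), and \<open>\<phi>(T\<^sub>n d)\<close> tends to \<open>x + \<phi>(d)\<close>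
  (\<open>translation_is_limit\<close>).  As \<open>\<phi>(Y)\<close> is compact, \<open>\<phi>\<close> is onto; Fatou's lemma for open sets shows that
  \<open>\<phi>\<^sub>*\<nu>\<close> is invariant under \<open>x\<close> (\<open>translated_law\<close>), so it is Haar measure, which is unique by
  Fubini's theorem (\<open>is_normalized_haar_unique\<close>).

  For injectivity let \<open>\<phi>(d) = \<phi>(d')\<close>.  The difference \<open>k\<close> of the two lifts takes values in
  \<open>{-2,...,2}\<close> and solves \<open>3 k\<^sub>s = k\<^sub>s\<^sub>a + k\<^sub>s\<^sub>b + d\<^sub>s - d'\<^sub>s\<close>.  Where \<open>k\<close> is positive it stays positive along
  an infinite tree of descendants, on which a digit \<open>1\<close> of \<open>d\<close> forces both children and a digit
  \<open>2\<close> at least one.  For random \<open>d\<close> the probability of reaching generation \<open>n + 1\<close> is \<open>1/3\<close> of the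
  probability that both subtrees reach generation \<open>n\<close>, plus \<open>1/3\<close> of the probability that at least
  one of them does, that is \<open>2/3\<close> of the probability for \<open>n\<close>
  (\<open>prob_survives\<close>).  So almost surely there is no such tree.  The exceptional set is a countable
  union of compact sets and a union of fibres of \<open>\<phi>\<close>, which makes the inverse of \<open>\<phi>\<close> off that set
  Borel.
\<close>

section \<open>The circle group and its product\<close>

lemma circle_of_eq_iff: "circle_of x = circle_of y \<longleftrightarrow> x - y \<in> \<int>"
  by transfer simp

lemma circle_of_surj: "\<exists>r. circle_of r = x"
proof transfer
  show "\<exists>r. r - x \<in> \<int>" for x :: real
    by (rule exI[of _ x]) simp
qed

lemma circle_of_hom:
  "circle_of (x + y) = circle_of x + circle_of y"
  "circle_of (x - y) = circle_of x - circle_of y"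
  "circle_of 0 = 0"
  "int_scale n (circle_of x) = circle_of (of_int n * x)"
  by (transfer; simp)+

lemma continuous_circle_of: "continuous_on UNIV circle_of"
  by (simp add: continuous_on_open_vimage open_circle_def)

lemma open_circle_of_image:
  assumes "open U"
  shows "open (circle_of ` U)"
proof -
  have "circle_of -` circle_of ` U = (\<Union>n. (\<lambda>x. of_int n + x) ` U)"
  proof (intro set_eqI iffI)
    fix x assume "x \<in> circle_of -` circle_of ` U"
    then obtain u where "u \<in> U" "x - u \<in> \<int>" by (auto simp: circle_of_eq_iff)
    then obtain n where "x = of_int n + u" by (metis Ints_cases diff_add_cancel)
    with \<open>u \<in> U\<close> show "x \<in> (\<Union>n. (\<lambda>x. of_int n + x) ` U)" by blast
  next
    fix x assume "x \<in> (\<Union>n. (\<lambda>x. of_int n + x) ` U)"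
    then obtain n u where "u \<in> U" "x = of_int n + u" by blast
    then have "circle_of x = circle_of u" by (simp add: circle_of_eq_iff)
    with \<open>u \<in> U\<close> show "x \<in> circle_of -` circle_of ` U" by simp
  qed
  moreover have "open \<dots>" by (intro open_UN ballI open_translation assms)
  ultimately show ?thesis by (simp add: open_circle_def)
qed

text \<open>The quotient map is open, so it carries a countable basis of the line to one of the circle.\<close>

instance circle :: second_countable_topology
proof
  obtain B :: "real set set" where B: "countable B" "topological_basis B"
    using ex_countable_basis by blast
  have "topological_basis ((`) circle_of ` B)"
  proof (rule topological_basisI)
    show "open U" if "U \<in> (`) circle_of ` B" for U
      using that B by (auto intro!: open_circle_of_image topological_basis_open)
  next
    fix W :: "circle set" and x assume "open W" "x \<in> W"
    moreover obtain r where "x = circle_of r" using circle_of_surj by metis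
    moreover have "open (circle_of -` W)" using \<open>open W\<close> by (simp add: open_circle_def)
    ultimately obtain V where "V \<in> B" "r \<in> V" "V \<subseteq> circle_of -` W"
      using topological_basisE[OF B(2), of "circle_of -` W" r] by auto
    with \<open>x = circle_of r\<close> show "\<exists>U\<in>(`) circle_of ` B. x \<in> U \<and> U \<subseteq> W"
      by (intro bexI[of _ "circle_of ` V"]) auto
  qed
  with B(1) show "\<exists>B :: circle set set. countable B \<and> open = generate_topology B"
    by (metis countable_image topological_basis_imp_subbasis)
qed

instance gen :: countable
  by countable_datatype

text \<open>With this instance the Borel sets of \<open>free2 \<Rightarrow> circle\<close> are those of the product \<open>\<sigma>\<close>-algebra.\<close>

instance free2 :: countable
proof (rule countable_classI)
  show "s = t" if "to_nat (word_of s) = to_nat (word_of t)" for s t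
    using that by (simp add: word_of_inject)
qed

text \<open>Addition is jointly continuous because \<^const>\<open>circle_of\<close> is an open map, so that the product of
  two copies of it is a quotient map.\<close>

lemma continuous_circle_add: "continuous_on UNIV (\<lambda>p :: circle \<times> circle. fst p + snd p)"
proof (unfold continuous_on_open_vimage[OF open_UNIV], intro allI impI)
  fix W :: "circle set" assume W: "open W"
  have cont: "open ((\<lambda>q. circle_of (fst q + snd q)) -` W)"
    by (intro open_vimage W continuous_on_compose2[OF continuous_circle_of] continuous_intros) auto
  show "open ((\<lambda>p :: circle \<times> circle. fst p + snd p) -` W \<inter> UNIV)"
  proof (rule open_prod_intro)
    fix p :: "circle \<times> circle" assume p: "p \<in> (\<lambda>p. fst p + snd p) -` W \<inter> UNIV"
    obtain r s where rs: "p = (circle_of r, circle_of s)" by (metis circle_of_surj surj_pair)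
    with p have "(r, s) \<in> (\<lambda>q. circle_of (fst q + snd q)) -` W" by (simp add: circle_of_hom(1))
    from open_prod_elim[OF cont this] obtain U V where UV: "open U" "open V" "(r, s) \<in> U \<times> V"
        "U \<times> V \<subseteq> (\<lambda>q. circle_of (fst q + snd q)) -` W" .
    have "p \<in> circle_of ` U \<times> circle_of ` V" using UV(3) by (simp add: rs)
    moreover have "circle_of u + circle_of v \<in> W" if "u \<in> U" "v \<in> V" for u v
      using subsetD[OF UV(4), of "(u, v)"] that by (simp add: circle_of_hom(1))
    then have "circle_of ` U \<times> circle_of ` V \<subseteq> (\<lambda>p. fst p + snd p) -` W \<inter> UNIV" by auto
    ultimately show "\<exists>A B. open A \<and> open B \<and> p \<in> A \<times> B \<and> A \<times> B \<subseteq> (\<lambda>p. fst p + snd p) -` W \<inter> UNIV"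
      using open_circle_of_image[OF UV(1)] open_circle_of_image[OF UV(2)] by blast
  qed
qed

lemma continuous_translation: "continuous_on UNIV ((+) (x :: free2 \<Rightarrow> circle))"
proof (rule continuous_on_coordinatewise_then_product)
  fix s
  have "continuous_on UNIV (\<lambda>y :: free2 \<Rightarrow> circle. (x s, y s))"
    by (intro continuous_intros continuous_on_product_coordinates)
  from continuous_on_compose2[OF continuous_circle_add this]
  show "continuous_on UNIV (\<lambda>y. (x + y) s)" by simp
qed

lemma measurable_fun_add:
  "(\<lambda>p :: (free2 \<Rightarrow> circle) \<times> (free2 \<Rightarrow> circle). fst p + snd p) \<in> borel \<Otimes>\<^sub>M borel \<rightarrow>\<^sub>M borel"
proof -
  have *: "(\<lambda>p. fst p + snd p) \<in> borel \<Otimes>\<^sub>M borel \<rightarrow>\<^sub>M (borel :: circle measure)"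
    by (rule borel_measurable_continuous_Pair[where H = "(+)", OF measurable_fst measurable_snd
          continuous_circle_add])
  have coord: "(\<lambda>y :: free2 \<Rightarrow> circle. y s) \<in> borel \<rightarrow>\<^sub>M borel" for s
    by (intro borel_measurable_continuous_onI continuous_on_product_coordinates)
  have "(\<lambda>p s. fst p s + snd p s) \<in>
      (borel :: (free2 \<Rightarrow> circle) measure) \<Otimes>\<^sub>M borel \<rightarrow>\<^sub>M PiM UNIV (\<lambda>_. borel :: circle measure)"
  proof (rule measurable_PiM_single')
    fix s
    have "(\<lambda>p. fst p s) \<in> (borel :: (free2 \<Rightarrow> circle) measure) \<Otimes>\<^sub>M borel \<rightarrow>\<^sub>M borel"
      "(\<lambda>p. snd p s) \<in> borel \<Otimes>\<^sub>M (borel :: (free2 \<Rightarrow> circle) measure) \<rightarrow>\<^sub>M borel"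
      by (rule measurable_compose[OF measurable_fst coord] measurable_compose[OF measurable_snd coord])+
    then have "(\<lambda>p. (fst p s, snd p s)) \<in> (borel :: (free2 \<Rightarrow> circle) measure) \<Otimes>\<^sub>M
        (borel :: (free2 \<Rightarrow> circle) measure) \<rightarrow>\<^sub>M (borel :: circle measure) \<Otimes>\<^sub>M borel"
      by (rule measurable_Pair)
    from measurable_compose[OF this *]
    show "(\<lambda>p. fst p s + snd p s) \<in> (borel :: (free2 \<Rightarrow> circle) measure) \<Otimes>\<^sub>M borel \<rightarrow>\<^sub>M borel"
      by (simp only: fst_conv snd_conv)
  qed (simp add: PiE_UNIV_domain)
  moreover have "(\<lambda>p s. fst p s + snd p s) = (\<lambda>p :: (free2 \<Rightarrow> circle) \<times> (free2 \<Rightarrow> circle). fst p + snd p)"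
    by (simp add: fun_eq_iff)
  ultimately have "(\<lambda>p :: (free2 \<Rightarrow> circle) \<times> (free2 \<Rightarrow> circle). fst p + snd p) \<in>
      borel \<Otimes>\<^sub>M borel \<rightarrow>\<^sub>M PiM UNIV (\<lambda>_. borel :: circle measure)"
    by (simp only:)
  then show ?thesis
    by (simp only: measurable_cong_sets[OF refl sets_PiM_equal_borel])
qed

section \<open>Uniqueness of normalized Haar measure\<close>

text \<open>The product measure of \<open>{(x, y). x + y \<in> E}\<close>, computed by slices in either order, is the measure of \<open>E\<close>
  under each of the two Haar measures.\<close>

lemma is_normalized_haar_unique:
  assumes grp: "\<And>x. x \<in> K \<Longrightarrow> - x \<in> K" "\<And>x y. x \<in> K \<Longrightarrow> y \<in> K \<Longrightarrow> x + y \<in> K"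
    and M: "is_normalized_haar K M" and N: "is_normalized_haar K N"
  shows "M = N"
proof (rule measure_eqI)
  have sM: "sets M = sets (restrict_space borel K)" and sN: "sets N = sets (restrict_space borel K)"
    using M N by (auto simp: is_normalized_haar_def)
  then show "sets M = sets N" by simp
  interpret M: prob_space M using M by (simp add: is_normalized_haar_def)
  interpret N: prob_space N using N by (simp add: is_normalized_haar_def)
  interpret MN: pair_sigma_finite M N ..
  have spM: "space M = K" and spN: "space N = K"
    using sets_eq_imp_space_eq[OF sM] sets_eq_imp_space_eq[OF sN] by (simp_all add: space_restrict_space)
  fix E assume E: "E \<in> sets M"
  then have EK: "E \<subseteq> K" using sets.sets_into_space spM by blast
  have [measurable]: "(\<lambda>x. x) \<in> M \<rightarrow>\<^sub>M borel" "(\<lambda>x. x) \<in> N \<rightarrow>\<^sub>M borel"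
    using measurable_restrict_space1[OF measurable_ident, of borel K]
    by (simp_all add: measurable_cong_sets[OF sM refl] measurable_cong_sets[OF sN refl] id_def)
  have "(\<lambda>p. (fst p, snd p)) \<in> M \<Otimes>\<^sub>M N \<rightarrow>\<^sub>M borel \<Otimes>\<^sub>M borel" by measurable
  from measurable_compose[OF this measurable_fun_add]
  have "(\<lambda>p. fst p + snd p) \<in> M \<Otimes>\<^sub>M N \<rightarrow>\<^sub>M restrict_space borel K"
    by (intro measurable_restrict_space2) (auto simp: space_pair_measure spM spN grp)
  then have meas: "(\<lambda>p. fst p + snd p) \<in> M \<Otimes>\<^sub>M N \<rightarrow>\<^sub>M M"
    by (simp add: measurable_cong_sets[OF refl sM])
  define S where "S = (\<lambda>p. fst p + snd p) -` E \<inter> space (M \<Otimes>\<^sub>M N)"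
  have S: "S \<in> sets (M \<Otimes>\<^sub>M N)" unfolding S_def by (rule measurable_sets[OF meas E])
  have inv: "emeasure M ((+) x ` E) = emeasure M E" "emeasure N ((+) x ` E) = emeasure N E"
    if "x \<in> K" for x
    using M N E that \<open>sets M = sets N\<close> unfolding is_normalized_haar_def by blast+
  have slice: "{y \<in> K. x + y \<in> E} = (+) (- x) ` E" if "x \<in> K" for x
  proof (intro set_eqI iffI)
    fix y assume "y \<in> {y \<in> K. x + y \<in> E}"
    then show "y \<in> (+) (- x) ` E" by (intro image_eqI[of _ _ "x + y"]) (auto simp: add.assoc[symmetric])
  next
    fix y assume "y \<in> (+) (- x) ` E"
    then obtain e where "e \<in> E" "y = - x + e" by blast
    then show "y \<in> {y \<in> K. x + y \<in> E}"
      using that EK grp(1)[of x] grp(2)[of "- x" e] by (auto simp: add.assoc[symmetric])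
  qed
  have "emeasure (M \<Otimes>\<^sub>M N) S = (\<integral>\<^sup>+x. emeasure N E \<partial>M)"
    unfolding N.emeasure_pair_measure_alt[OF S]
  proof (rule nn_integral_cong)
    fix x assume "x \<in> space M"
    then have x: "x \<in> K" by (simp add: spM)
    have "Pair x -` S = {y \<in> K. x + y \<in> E}" by (auto simp: S_def space_pair_measure spM spN x)
    then show "emeasure N (Pair x -` S) = emeasure N E"
      using inv(2)[OF grp(1)[OF x]] slice[OF x] by argo
  qed
  moreover have "emeasure (M \<Otimes>\<^sub>M N) S = (\<integral>\<^sup>+y. emeasure M E \<partial>N)"
    unfolding MN.emeasure_pair_measure_alt2[OF S]
  proof (rule nn_integral_cong)
    fix x assume "x \<in> space N"
    then have x: "x \<in> K" by (simp add: spN)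
    have "(\<lambda>y. (y, x)) -` S = {y \<in> K. x + y \<in> E}"
      by (auto simp: S_def space_pair_measure spM spN x add.commute)
    then show "emeasure M ((\<lambda>y. (y, x)) -` S) = emeasure M E"
      using inv(1)[OF grp(1)[OF x]] slice[OF x] by argo
  qed
  ultimately show "emeasure M E = emeasure N E"
    by (simp add: M.emeasure_space_1 N.emeasure_space_1)
qed

lemma normalized_haar_eqI:
  assumes "\<And>x. x \<in> K \<Longrightarrow> - x \<in> K" "\<And>x y. x \<in> K \<Longrightarrow> y \<in> K \<Longrightarrow> x + y \<in> K"
    and "is_normalized_haar K M"
  shows "normalized_haar K = M"
  unfolding normalized_haar_def using assms is_normalized_haar_unique by (intro the_equality) blast+

section \<open>Measure-preserving maps of the full 3-shift\<close>

abbreviation "three \<equiv> uniform_count_measure {0, 1, 2 :: int}"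
abbreviation "\<nu> \<equiv> full_3_shift_measure"

lemma full_3_shift_digit: "d \<in> full_3_shift \<Longrightarrow> d s \<in> {0, 1, 2}"
  by (auto simp: full_3_shift_def)

lemma mod_3_digit: "(x :: int) mod 3 \<in> {0, 1, 2}"
  by auto

lemma prob_space_three: "prob_space three"
  by (rule prob_space_uniform_count_measure) auto

lemma prob_space_full_3_shift_measure: "prob_space \<nu>"
  unfolding full_3_shift_measure_def bernoulli_measure_def
  by (intro prob_space_PiM prob_space_three)

interpretation nu: prob_space "\<nu>"
  by (rule prob_space_full_3_shift_measure)

lemma measurable_coordinate [measurable]: "(\<lambda>d. d s) \<in> \<nu> \<rightarrow>\<^sub>M count_space UNIV"
proof -
  have "(\<lambda>d. d s) \<in> \<nu> \<rightarrow>\<^sub>M three"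
    unfolding full_3_shift_measure_def bernoulli_measure_def by (rule measurable_component_singleton) simp
  moreover have "(\<lambda>x. x) \<in> three \<rightarrow>\<^sub>M count_space UNIV"
    by (simp add: measurable_def sets_uniform_count_measure space_uniform_count_measure)
  ultimately show ?thesis by (rule measurable_compose)
qed

lemma measurable_add_mod_3 [measurable]:
  fixes f g :: "'a \<Rightarrow> int"
  assumes f: "f \<in> M \<rightarrow>\<^sub>M count_space UNIV" and g: "g \<in> M \<rightarrow>\<^sub>M count_space UNIV"
  shows "(\<lambda>x. (f x + g x) mod 3) \<in> M \<rightarrow>\<^sub>M count_space UNIV"
  by (rule measurable_compose_countable[OF measurable_compose[OF g] f]) simp

lemma measurable_into_full_3_shift:
  assumes "\<And>s. (\<lambda>x. T x s) \<in> N \<rightarrow>\<^sub>M count_space UNIV" "\<And>x. x \<in> space N \<Longrightarrow> T x \<in> full_3_shift"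
  shows "T \<in> N \<rightarrow>\<^sub>M \<nu>"
  unfolding full_3_shift_measure_def bernoulli_measure_def
proof (rule measurable_PiM_single)
  show "T \<in> space N \<rightarrow> (\<Pi>\<^sub>E i\<in>UNIV. space three)"
    using assms(2) by (auto simp: space_uniform_count_measure full_3_shift_def)
  show "{x \<in> space N. T x s \<in> A} \<in> sets N" for A s
    using measurable_sets[OF assms(1)[of s], of A] by (simp add: vimage_def Int_def conj_commute)
qed

text \<open>A finite cylinder only tests finitely many coordinates of \<open>T d\<close>; this is what allows maps that change
  infinitely many coordinates to be reduced to finite compositions.\<close>

lemma measure_preserving_if_cylinders:
  assumes T: "T \<in> \<nu> \<rightarrow>\<^sub>M \<nu>"
    and cyl: "\<And>J A. finite J \<Longrightarrow> emeasure \<nu> {d \<in> full_3_shift. \<forall>s\<in>J. T d s \<in> A s} =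
      emeasure \<nu> {d \<in> full_3_shift. \<forall>s\<in>J. d s \<in> A s}"
  shows "distr \<nu> \<nu> T = \<nu>"
proof -
  have emb: "prod_emb UNIV (\<lambda>_. three) J (Pi\<^sub>E J A) = {d \<in> full_3_shift. \<forall>s\<in>J. d s \<in> A s}" for J A
    by (auto simp: prod_emb_def full_3_shift_def space_uniform_count_measure PiE_iff)
  have "distr \<nu> \<nu> T = PiM UNIV (\<lambda>_. three)"
  proof (rule measure_eqI_PiM_infinite)
    show "sets (distr \<nu> \<nu> T) = sets (PiM UNIV (\<lambda>_. three))"
      by (simp add: full_3_shift_measure_def bernoulli_measure_def)
    show "finite_measure (distr \<nu> \<nu> T)"
      by (intro prob_space.finite_measure nu.prob_space_distr T)
    fix A :: "free2 \<Rightarrow> int set" and J assume J: "finite J" "\<And>i. i \<in> J \<Longrightarrow> A i \<in> sets three"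
    have "{d \<in> full_3_shift. \<forall>s\<in>J. d s \<in> A s} \<in> sets \<nu>"
      unfolding emb[symmetric] full_3_shift_measure_def bernoulli_measure_def
      using J by (intro sets_PiM_I) auto
    then have "emeasure (distr \<nu> \<nu> T) {d \<in> full_3_shift. \<forall>s\<in>J. d s \<in> A s} =
        emeasure \<nu> (T -` {d \<in> full_3_shift. \<forall>s\<in>J. d s \<in> A s} \<inter> space \<nu>)"
      by (rule emeasure_distr[OF T])
    also have "T -` {d \<in> full_3_shift. \<forall>s\<in>J. d s \<in> A s} \<inter> space \<nu> =
        {d \<in> full_3_shift. \<forall>s\<in>J. T d s \<in> A s}"
      using measurable_space[OF T] by (auto simp: space_full_3_shift_measure)
    finally show "emeasure (distr \<nu> \<nu> T) (prod_emb UNIV (\<lambda>_. three) J (Pi\<^sub>E J A)) =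
        emeasure (PiM UNIV (\<lambda>_. three)) (prod_emb UNIV (\<lambda>_. three) J (Pi\<^sub>E J A))"
      using cyl[OF J(1), of A]
      by (simp add: emb full_3_shift_measure_def[symmetric] bernoulli_measure_def[symmetric])
  qed simp
  then show ?thesis by (simp add: full_3_shift_measure_def bernoulli_measure_def)
qed

lemma distr_rotate:
  "(\<lambda>d. d(s := (d s + j) mod 3)) \<in> \<nu> \<rightarrow>\<^sub>M \<nu>"
  "distr \<nu> \<nu> (\<lambda>d. d(s := (d s + j) mod 3)) = \<nu>"
proof -
  let ?R = "\<lambda>d. d(s := (d s + j) mod 3)"
  show R: "?R \<in> \<nu> \<rightarrow>\<^sub>M \<nu>"
  proof (rule measurable_into_full_3_shift)
    show "(\<lambda>d. ?R d t) \<in> \<nu> \<rightarrow>\<^sub>M count_space UNIV" for t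
      by (cases "t = s") simp_all
    show "?R d \<in> full_3_shift" if "d \<in> space \<nu>" for d
      using that mod_3_digit by (auto simp: space_full_3_shift_measure full_3_shift_def)
  qed
  show "distr \<nu> \<nu> ?R = \<nu>"
  proof (rule measure_preserving_if_cylinders[OF R])
    fix J :: "free2 set" and A :: "free2 \<Rightarrow> int set" assume J: "finite J"
    \<comment> \<open>Rotation by \<open>j\<close> is a bijection from the digits \<open>A' s\<close> onto the digits \<open>A'' s\<close>, the part of \<open>A s\<close>
      that the measure sees.\<close>
    define A' where "A' t = {x \<in> {0, 1, 2}. (if t = s then (x + j) mod 3 else x) \<in> A t}" for t
    define A'' where "A'' t = A t \<inter> {0, 1, 2}" for t
    have cyl: "emeasure \<nu> {d \<in> full_3_shift. \<forall>t\<in>J. d t \<in> C t} = (\<Prod>t\<in>J. emeasure three (C t))"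
      if C: "\<And>t. C t \<subseteq> {0, 1, 2}" for C
    proof -
      have "{d \<in> full_3_shift. \<forall>t\<in>J. d t \<in> C t} = prod_emb UNIV (\<lambda>_. three) J (Pi\<^sub>E J C)"
        by (auto simp: prod_emb_def full_3_shift_def space_uniform_count_measure PiE_iff)
      also have "emeasure \<nu> \<dots> = (\<Prod>t\<in>J. emeasure three (C t))"
        unfolding full_3_shift_measure_def bernoulli_measure_def
        using C by (intro emeasure_PiM_emb prob_space_three J) (auto simp: sets_uniform_count_measure)
      finally show ?thesis .
    qed
    have "card (A' t) = card (A'' t)" for t
    proof (rule bij_betw_same_card)
      let ?h = "\<lambda>x. if t = s then (x + j) mod 3 else x"
      show "bij_betw ?h (A' t) (A'' t)"
      proof (rule bij_betw_byWitness[where f' = "\<lambda>x. if t = s then (x - j) mod 3 else x"])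
        show "\<forall>x\<in>A' t. (if t = s then (?h x - j) mod 3 else ?h x) = x"
          by (auto simp: A'_def mod_diff_left_eq)
        show "\<forall>x\<in>A'' t. ?h (if t = s then (x - j) mod 3 else x) = x"
          by (auto simp: A''_def mod_add_left_eq)
        show "?h ` A' t \<subseteq> A'' t"
          using mod_3_digit by (auto simp: A'_def A''_def)
        show "(\<lambda>x. if t = s then (x - j) mod 3 else x) ` A'' t \<subseteq> A' t"
        proof
          fix y assume "y \<in> (\<lambda>x. if t = s then (x - j) mod 3 else x) ` A'' t"
          then obtain x where x: "x \<in> A'' t" "y = (if t = s then (x - j) mod 3 else x)" by blast
          then have "(if t = s then (y + j) mod 3 else y) = x"
            by (auto simp: A''_def mod_add_left_eq)
          moreover have "y \<in> {0, 1, 2}" using x mod_3_digit by (auto simp: A''_def)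
          ultimately show "y \<in> A' t" using x(1) by (simp add: A'_def A''_def)
        qed
      qed
    qed
    then have three_eq: "emeasure three (A' t) = emeasure three (A'' t)" for t
      by (subst (1 2) emeasure_uniform_count_measure) (auto simp: A'_def A''_def)
    have cyl_eq: "{d \<in> full_3_shift. \<forall>t\<in>J. ?R d t \<in> A t} = {d \<in> full_3_shift. \<forall>t\<in>J. d t \<in> A' t}"
      "{d \<in> full_3_shift. \<forall>t\<in>J. d t \<in> A t} = {d \<in> full_3_shift. \<forall>t\<in>J. d t \<in> A'' t}"
      by (auto simp: A'_def A''_def full_3_shift_def)
    show "emeasure \<nu> {d \<in> full_3_shift. \<forall>t\<in>J. ?R d t \<in> A t} =
        emeasure \<nu> {d \<in> full_3_shift. \<forall>t\<in>J. d t \<in> A t}"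
    proof -
      have "\<And>t. A' t \<subseteq> {0, 1, 2}" "\<And>t. A'' t \<subseteq> {0, 1, 2}" by (auto simp: A'_def A''_def)
      from cyl[of A', OF this(1)] cyl[of A'', OF this(2)] show ?thesis
        by (simp only: three_eq cyl_eq)
    qed
  qed
qed

text \<open>On each level set of \<open>g\<close> the map is a rotation by a constant, and that level set is invariant
  under rotations of coordinate \<open>s\<close> because \<open>g\<close> does not look at it.\<close>

lemma distr_rotate_dependent:
  fixes g :: "(free2 \<Rightarrow> int) \<Rightarrow> int"
  assumes g: "g \<in> \<nu> \<rightarrow>\<^sub>M count_space UNIV" and indep: "\<And>d x. g (d(s := x)) = g d"
  shows "(\<lambda>d. d(s := (d s + g d) mod 3)) \<in> \<nu> \<rightarrow>\<^sub>M \<nu>"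
    "distr \<nu> \<nu> (\<lambda>d. d(s := (d s + g d) mod 3)) = \<nu>"
proof -
  let ?R = "\<lambda>j d. d(s := (d s + j) mod 3)" and ?U = "\<lambda>d. d(s := (d s + g d) mod 3)"
  note [measurable] = g
  show U: "?U \<in> \<nu> \<rightarrow>\<^sub>M \<nu>"
  proof (rule measurable_into_full_3_shift)
    show "(\<lambda>d. ?U d t) \<in> \<nu> \<rightarrow>\<^sub>M count_space UNIV" for t
      by (cases "t = s") simp_all
    show "?U d \<in> full_3_shift" if "d \<in> space \<nu>" for d
      using measurable_space[OF distr_rotate(1) that, of s "g d"] by (simp add: space_full_3_shift_measure)
  qed
  show "distr \<nu> \<nu> ?U = \<nu>"
  proof (rule measure_eqI)
    fix A assume "A \<in> sets (distr \<nu> \<nu> ?U)"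
    then have A [measurable]: "A \<in> sets \<nu>" by simp
    define G where "G j = {d \<in> space \<nu>. g d = j}" for j
    have G: "G j \<in> sets \<nu>" for j unfolding G_def by measurable
    have piece: "emeasure \<nu> ((?U -` A \<inter> space \<nu>) \<inter> G j) = emeasure \<nu> (A \<inter> G j)" for j
    proof -
      have "(?U -` A \<inter> space \<nu>) \<inter> G j = ?R j -` (A \<inter> G j) \<inter> space \<nu>"
        using measurable_space[OF distr_rotate(1), of _ s j] by (auto simp: G_def indep)
      then show ?thesis
        using emeasure_distr[OF distr_rotate(1), of "A \<inter> G j" s j] G A
        by (simp add: distr_rotate(2))
    qed
    have sum: "emeasure \<nu> B = suminf (\<lambda>n. emeasure \<nu> (B \<inter> G (int_decode n)))" if B: "B \<in> sets \<nu>" for B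
    proof -
      have "suminf (\<lambda>n. emeasure \<nu> (B \<inter> G (int_decode n))) = emeasure \<nu> (\<Union>n. B \<inter> G (int_decode n))"
        using B G by (intro suminf_emeasure) (auto simp: disjoint_family_on_def G_def int_decode_eq)
      also have "(\<Union>n. B \<inter> G (int_decode n)) = B"
      proof
        show "B \<subseteq> (\<Union>n. B \<inter> G (int_decode n))"
        proof
          fix d assume "d \<in> B"
          then have "d \<in> B \<inter> G (int_decode (int_encode (g d)))"
            using sets.sets_into_space[OF B] by (auto simp: G_def)
          then show "d \<in> (\<Union>n. B \<inter> G (int_decode n))" by blast
        qed
      qed blast
      finally show ?thesis by simp
    qed
    have "emeasure (distr \<nu> \<nu> ?U) A = emeasure \<nu> (?U -` A \<inter> space \<nu>)"
      by (rule emeasure_distr[OF U A])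
    also have "\<dots> = emeasure \<nu> A"
      using sum[OF measurable_sets[OF U A]] sum[OF A] by (simp add: piece)
    finally show "emeasure (distr \<nu> \<nu> ?U) A = emeasure \<nu> A" .
  qed simp
qed

definition twist :: "(free2 \<Rightarrow> (free2 \<Rightarrow> int) \<Rightarrow> int) \<Rightarrow> free2 set \<Rightarrow> (free2 \<Rightarrow> int) \<Rightarrow> free2 \<Rightarrow> int" where
  "twist g J d = (\<lambda>s. if s \<in> J then (d s + g s d) mod 3 else d s)"

lemma measurable_twist:
  assumes [measurable]: "\<And>s. g s \<in> \<nu> \<rightarrow>\<^sub>M count_space UNIV"
  shows "twist g J \<in> \<nu> \<rightarrow>\<^sub>M \<nu>"
proof (rule measurable_into_full_3_shift)
  show "(\<lambda>d. twist g J d s) \<in> \<nu> \<rightarrow>\<^sub>M count_space UNIV" for s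
    unfolding twist_def by (cases "s \<in> J") simp_all
  show "twist g J d \<in> full_3_shift" if "d \<in> space \<nu>" for d
    using that mod_3_digit by (auto simp: space_full_3_shift_measure full_3_shift_def twist_def)
qed

text \<open>For finite \<open>J\<close> the twist is a composition of changes of single coordinates.  Changing the coordinate of
  smallest height first does not disturb the quantities on which the later changes depend.  For infinite
  \<open>J\<close> only the coordinates tested by a cylinder matter.\<close>

lemma distr_twist:
  fixes h :: "free2 \<Rightarrow> int"
  assumes g [measurable]: "\<And>s. g s \<in> \<nu> \<rightarrow>\<^sub>M count_space UNIV"
    and tri: "\<And>s t d x. h s \<le> h t \<Longrightarrow> g t (d(s := x)) = g t d"
  shows "distr \<nu> \<nu> (twist g J) = \<nu>"
proof -
  have finite: "distr \<nu> \<nu> (twist g J) = \<nu>" if "finite J" for J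
    using that
  proof (induction "card J" arbitrary: J)
    case 0
    then have "twist g J = (\<lambda>d. d)" by (simp add: twist_def fun_eq_iff)
    then show ?case using distr_id[of \<nu>] by (simp add: id_def)
  next
    case (Suc n)
    then obtain s where s: "s \<in> J" "\<And>t. t \<in> J \<Longrightarrow> h s \<le> h t"
      using arg_min_if_finite[of J h] 
      by (metis card.empty linorder_not_less nat.distinct(1))
    let ?U = "\<lambda>d. d(s := (d s + g s d) mod 3)"
    have "twist g J = twist g (J - {s}) \<circ> ?U"
      using s by (auto simp: twist_def fun_eq_iff tri)
    then have "distr \<nu> \<nu> (twist g J) = distr (distr \<nu> \<nu> ?U) \<nu> (twist g (J - {s}))"
      using distr_distr[OF measurable_twist[of g "J - {s}"] distr_rotate_dependent(1)[of "g s" s]]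
      by (simp add: tri)
    also have "\<dots> = distr \<nu> \<nu> (twist g (J - {s}))"
      by (simp add: distr_rotate_dependent(2) tri)
    also have "\<dots> = \<nu>"
      using Suc.hyps(2) Suc.prems s(1) by (intro Suc.hyps(1)) simp_all
    finally show ?case .
  qed
  show ?thesis
  proof (rule measure_preserving_if_cylinders[OF measurable_twist[OF g]])
    fix I :: "free2 set" and A :: "free2 \<Rightarrow> int set" assume "finite I"
    have cyl: "{d \<in> full_3_shift. \<forall>s\<in>I. d s \<in> A s} \<in> sets \<nu>"
    proof -
      have "{d \<in> space \<nu>. \<forall>s\<in>I. d s \<in> A s} \<in> sets \<nu>"
        using \<open>finite I\<close> by measurable
      then show ?thesis by (simp add: space_full_3_shift_measure)
    qed
    have T: "twist g (J \<inter> I) \<in> \<nu> \<rightarrow>\<^sub>M \<nu>" by (rule measurable_twist[OF g])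
    have "{d \<in> full_3_shift. \<forall>s\<in>I. twist g J d s \<in> A s} =
        twist g (J \<inter> I) -` {d \<in> full_3_shift. \<forall>s\<in>I. d s \<in> A s} \<inter> space \<nu>"
      using measurable_space[OF T] by (auto simp: space_full_3_shift_measure twist_def)
    also have "emeasure \<nu> \<dots> = emeasure (distr \<nu> \<nu> (twist g (J \<inter> I))) {d \<in> full_3_shift. \<forall>s\<in>I. d s \<in> A s}"
      by (rule emeasure_distr[OF T cyl, symmetric])
    finally show "emeasure \<nu> {d \<in> full_3_shift. \<forall>s\<in>I. twist g J d s \<in> A s} =
        emeasure \<nu> {d \<in> full_3_shift. \<forall>s\<in>I. d s \<in> A s}"
      using \<open>finite I\<close> by (simp add: finite)
  qed
qed

section \<open>The real lift of the homoclinic map\<close>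

definition real_lift :: "(free2 \<Rightarrow> int) \<Rightarrow> free2 \<Rightarrow> real" where
  "real_lift d = rmul (\<lambda>n r. of_int n * r) d w_delta"

text \<open>Finite approximations of \<^const>\<open>real_lift\<close> that depend on finitely many coordinates.  Continuity,
  measurability, equivariance and the bounds of the lift are inherited from them.\<close>

primrec iterated_lift :: "nat \<Rightarrow> (free2 \<Rightarrow> int) \<Rightarrow> free2 \<Rightarrow> real" where
  "iterated_lift 0 d s = 0"
| "iterated_lift (Suc n) d s =
     (of_int (d s) + iterated_lift n d (s + gen_a) + iterated_lift n d (s + gen_b)) / 3"

lemma homoclinic_map_eq: "homoclinic_map d s = circle_of (real_lift d s)"
  by (simp add: homoclinic_map_def real_lift_def)

lemma has_sum_w_delta_translate: "((\<lambda>t. w_delta (- t + s)) has_sum infsum w_delta UNIV) UNIV"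
proof -
  have "bij (\<lambda>t :: free2. - t + s)"
  proof (rule bij_betw_byWitness[where f' = "\<lambda>t. s - t"])
    show "\<forall>t\<in>UNIV. s - (- t + s) = t"
      using add_diff_cancel[of t "- t + s" for t] by simp
    show "\<forall>t\<in>UNIV. - (s - t) + s = t" by simp
  qed auto
  from has_sum_reindex_bij_betw[OF this, of w_delta] show ?thesis
    using w_delta_summable by (simp add: has_sum_infsum)
qed

lemma w_delta_nonneg: "0 \<le> w_delta s"
  by (simp add: w_delta_def)

lemma full_3_shift_bounds:
  assumes "d \<in> full_3_shift"
  shows "0 \<le> d t" "d t \<le> 2"
  using full_3_shift_digit[OF assms, of t] by auto

lemma summand_bounds:
  assumes "d \<in> full_3_shift"
  shows "real_of_int (d t) * w_delta s \<le> 2 * w_delta s" "0 \<le> real_of_int (d t) * w_delta s"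
proof -
  have "real_of_int (d t) \<le> 2" "0 \<le> real_of_int (d t)"
    using full_3_shift_bounds[OF assms, of t] by simp_all
  from mult_right_mono[OF this(1) w_delta_nonneg] mult_nonneg_nonneg[OF this(2) w_delta_nonneg]
  show "real_of_int (d t) * w_delta s \<le> 2 * w_delta s" "0 \<le> real_of_int (d t) * w_delta s" .
qed

lemma real_lift_summable:
  assumes "d \<in> full_3_shift"
  shows "(\<lambda>t. of_int (d t) * w_delta (- t + s)) summable_on UNIV"
proof (rule summable_on_comparison_test)
  show "(\<lambda>t. 2 * w_delta (- t + s)) summable_on UNIV"
    by (rule summable_on_cmult_right[OF has_sum_imp_summable[OF has_sum_w_delta_translate]])
qed (rule summand_bounds[OF assms])+

lemma real_lift_has_sum:
  "d \<in> full_3_shift \<Longrightarrow> ((\<lambda>t. of_int (d t) * w_delta (- t + s)) has_sum real_lift d s) UNIV"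
  unfolding real_lift_def rmul_def by (intro has_sum_infsum real_lift_summable)

lemma real_lift_bounded:
  assumes "d \<in> full_3_shift"
  shows "0 \<le> real_lift d s" "real_lift d s \<le> 2 * infsum w_delta UNIV"
proof -
  show "0 \<le> real_lift d s"
    by (rule has_sum_nonneg[OF real_lift_has_sum[OF assms, of s] summand_bounds(2)[OF assms]])
  show "real_lift d s \<le> 2 * infsum w_delta UNIV"
    by (rule has_sum_mono[OF real_lift_has_sum[OF assms, of s]
          has_sum_cmult_right[OF has_sum_w_delta_translate] summand_bounds(1)[OF assms]])
qed

text \<open>This is \<open>(d \<cdot> w\<^sup>\<Delta>) \<cdot> f\<^sup>* = d\<close>, a consequence of \<open>w\<^sup>\<Delta> \<cdot> f\<^sup>* = 1\<close>.\<close>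

lemma real_lift_recursion:
  assumes "d \<in> full_3_shift"
  shows "3 * real_lift d s - real_lift d (s + gen_a) - real_lift d (s + gen_b) = of_int (d s)"
proof (rule has_sum_unique)
  let ?F = "\<lambda>s t. of_int (d t) * w_delta (- t + s)"
  note sums = real_lift_has_sum[OF assms]
  have "((\<lambda>t. 3 * ?F s t + - ?F (s + gen_a) t + - ?F (s + gen_b) t) has_sum
      3 * real_lift d s + - real_lift d (s + gen_a) + - real_lift d (s + gen_b)) UNIV"
    by (intro has_sum_add has_sum_cmult_right has_sum_uminusI sums)
  then show "((\<lambda>t. 3 * ?F s t - ?F (s + gen_a) t - ?F (s + gen_b) t) has_sum
      3 * real_lift d s - real_lift d (s + gen_a) - real_lift d (s + gen_b)) UNIV"
    by (simp only: diff_conv_add_uminus)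
  have eq_0: "- t + s = 0 \<longleftrightarrow> t = s" for t :: free2
    by (metis add_minus_cancel add_0_right left_minus)
  have "3 * ?F s t - ?F (s + gen_a) t - ?F (s + gen_b) t = (if t = s then of_int (d s) else 0)" for t
  proof -
    have "3 * ?F s t - ?F (s + gen_a) t - ?F (s + gen_b) t = of_int (d t) *
        (3 * w_delta (- t + s) - w_delta (- t + s + gen_a) - w_delta (- t + s + gen_b))"
      by (simp add: algebra_simps)
    also have "\<dots> = (if t = s then of_int (d s) else 0)"
      unfolding w_delta_right by (simp add: indicator_def eq_0)
    finally show ?thesis .
  qed
  moreover have "((\<lambda>t. if t = s then real_of_int (d s) else 0) has_sum of_int (d s)) UNIV"
    using has_sum_finite_neutralI[of "{s}" UNIV "\<lambda>t. if t = s then real_of_int (d s) else 0"] by simp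
  ultimately show "((\<lambda>t. 3 * ?F s t - ?F (s + gen_a) t - ?F (s + gen_b) t) has_sum of_int (d s)) UNIV"
    by simp
qed

lemma iterated_lift_bounds:
  assumes "d \<in> full_3_shift"
  shows "0 \<le> iterated_lift n d s \<and> iterated_lift n d s \<le> 2"
proof (induction n arbitrary: s)
  case (Suc n)
  show ?case
    using Suc[of "s + gen_a"] Suc[of "s + gen_b"] full_3_shift_bounds[OF assms, of s] by simp
qed simp

text \<open>Errors contract by the factor \<open>2/3\<close> per generation: there are two children, and each passes on one
  third of its error.\<close>

lemma contraction:
  fixes e :: "nat \<Rightarrow> free2 \<Rightarrow> real"
  assumes "\<And>s. \<bar>e 0 s\<bar> \<le> C"
    and "\<And>n s. \<bar>e (Suc n) s\<bar> \<le> (\<bar>e n (s + gen_a)\<bar> + \<bar>e n (s + gen_b)\<bar>) / 3"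
  shows "\<bar>e n s\<bar> \<le> C * (2/3) ^ n"
proof (induction n arbitrary: s)
  case (Suc n)
  show ?case
    using assms(2)[of n s] Suc[of "s + gen_a"] Suc[of "s + gen_b"] by simp
qed (use assms(1) in simp)

lemma abs_third:
  fixes x y z :: real
  assumes "3 * x = y + z"
  shows "\<bar>x\<bar> \<le> (\<bar>y\<bar> + \<bar>z\<bar>) / 3"
proof -
  have "3 * \<bar>x\<bar> \<le> \<bar>y\<bar> + \<bar>z\<bar>" using assms by linarith
  then show ?thesis by simp
qed

lemma recursion_diff:
  fixes r ra rb i ia ib c :: real
  assumes "3 * r - ra - rb = c" "i = (c + ia + ib) / 3"
  shows "3 * (r - i) = (ra - ia) + (rb - ib)"
proof -
  have "3 * i = c + ia + ib" unfolding assms(2) by simp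
  then show ?thesis using assms(1) by (simp add: algebra_simps)
qed

lemma iterated_lift_error:
  assumes "d \<in> full_3_shift"
  shows "\<bar>real_lift d s - iterated_lift n d s\<bar> \<le> (2 * infsum w_delta UNIV) * (2/3) ^ n"
proof (rule contraction[where e = "\<lambda>n s. real_lift d s - iterated_lift n d s"])
  show "\<bar>real_lift d s - iterated_lift 0 d s\<bar> \<le> 2 * infsum w_delta UNIV" for s
    unfolding iterated_lift.simps diff_0_right abs_of_nonneg[OF real_lift_bounded(1)[OF assms]]
    by (rule real_lift_bounded(2)[OF assms])
  show "\<bar>real_lift d s - iterated_lift (Suc n) d s\<bar> \<le> (\<bar>real_lift d (s + gen_a) - iterated_lift n d (s + gen_a)\<bar> +
      \<bar>real_lift d (s + gen_b) - iterated_lift n d (s + gen_b)\<bar>) / 3" for n s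
  proof -
    have eq: "3 * (real_lift d s - iterated_lift (Suc n) d s) = (real_lift d (s + gen_a) - iterated_lift n d (s + gen_a)) +
      (real_lift d (s + gen_b) - iterated_lift n d (s + gen_b))"
      by (rule recursion_diff[OF real_lift_recursion[OF assms, of s] iterated_lift.simps(2)[of n d s]])
    show ?thesis by (rule abs_third[OF eq])
  qed
qed

lemma power_two_thirds_tendsto_0: "(\<lambda>n. C * (2/3 :: real) ^ n) \<longlonglongrightarrow> 0"
  by (intro tendsto_mult_right_zero LIMSEQ_power_zero) simp

lemma iterated_lift_tendsto:
  assumes "d \<in> full_3_shift"
  shows "(\<lambda>n. iterated_lift n d s) \<longlonglongrightarrow> real_lift d s"
proof -
  have "(\<lambda>n. real_lift d s - iterated_lift n d s) \<longlonglongrightarrow> 0"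
    using iterated_lift_error[OF assms]
    by (intro Lim_null_comparison[OF _ power_two_thirds_tendsto_0[of "2 * infsum w_delta UNIV"]]
        always_eventually) (simp only: real_norm_def, blast)
  from tendsto_diff[OF tendsto_const this, of "real_lift d s"] show ?thesis
    by (simp only: diff_diff_eq2 add_diff_cancel_left' diff_0_right)
qed

lemma real_lift_bounds:
  assumes "d \<in> full_3_shift"
  shows "0 \<le> real_lift d s" "real_lift d s \<le> 2"
proof -
  show "0 \<le> real_lift d s"
    using iterated_lift_bounds[OF assms]
    by (intro LIMSEQ_le_const[OF iterated_lift_tendsto[OF assms]]) blast
  show "real_lift d s \<le> 2"
    using iterated_lift_bounds[OF assms]
    by (intro LIMSEQ_le_const2[OF iterated_lift_tendsto[OF assms]]) blast
qed

lemma continuous_real_lift: "continuous_on full_3_shift (\<lambda>d. real_lift d s)"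
proof (rule uniform_limit_theorem)
  have "continuous_on full_3_shift (\<lambda>d. iterated_lift n d s)" for n
  proof (induction n arbitrary: s)
    case (Suc n)
    have "continuous_on full_3_shift (\<lambda>d. real_of_int (d s))"
      by (intro continuous_on_of_int continuous_on_product_coordinates[THEN continuous_on_subset]) simp
    with Suc show ?case unfolding iterated_lift.simps by (intro continuous_on_divide continuous_on_add continuous_on_const) auto
  qed simp
  then show "\<forall>\<^sub>F n in sequentially. continuous_on full_3_shift (\<lambda>d. iterated_lift n d s)" by simp
  show "uniform_limit full_3_shift (\<lambda>n d. iterated_lift n d s) (\<lambda>d. real_lift d s) sequentially"
  proof (rule uniform_limitI)
    fix e :: real assume "e > 0"
    then have "\<forall>\<^sub>F n in sequentially. (2 * infsum w_delta UNIV) * (2/3) ^ n < e"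
      using power_two_thirds_tendsto_0 by (rule order_tendstoD(2)[rotated])
    then show "\<forall>\<^sub>F n in sequentially. \<forall>d\<in>full_3_shift. dist (iterated_lift n d s) (real_lift d s) < e"
    proof eventually_elim
      case (elim n)
      then show ?case
        using iterated_lift_error[of _ s n] by (force simp: dist_real_def abs_minus_commute)
    qed
  qed
qed simp

lemma continuous_homoclinic_map: "continuous_on full_3_shift homoclinic_map"
proof (rule continuous_on_coordinatewise_then_product)
  show "continuous_on full_3_shift (\<lambda>d. homoclinic_map d s)" for s
    unfolding homoclinic_map_eq
    by (rule continuous_on_compose2[OF continuous_circle_of continuous_real_lift]) simp
qed

lemma measurable_real_lift [measurable]: "(\<lambda>d. real_lift d s) \<in> borel_measurable \<nu>"
proof (rule borel_measurable_LIMSEQ_real)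
  show "(\<lambda>n. iterated_lift n d s) \<longlonglongrightarrow> real_lift d s" if "d \<in> space \<nu>" for d
    using that iterated_lift_tendsto by (simp add: space_full_3_shift_measure)
  show "(\<lambda>d. iterated_lift n d s) \<in> borel_measurable \<nu>" for n
  proof (induction n arbitrary: s)
    case (Suc n)
    note [measurable] = Suc
    have [measurable]: "(\<lambda>d. real_of_int (d s)) \<in> borel_measurable \<nu>"
      by (rule measurable_compose[OF measurable_coordinate]) simp
    show ?case by simp
  qed simp
qed

lemma measurable_homoclinic_map: "homoclinic_map \<in> \<nu> \<rightarrow>\<^sub>M borel"
proof -
  have "(\<lambda>d s. homoclinic_map d s) \<in> \<nu> \<rightarrow>\<^sub>M PiM UNIV (\<lambda>_. borel :: circle measure)"
  proof (rule measurable_PiM_single')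
    show "(\<lambda>d. homoclinic_map d s) \<in> borel_measurable \<nu>" for s
      unfolding homoclinic_map_eq
      by (rule measurable_compose[OF measurable_real_lift borel_measurable_continuous_onI[OF continuous_circle_of]])
  qed (simp add: PiE_UNIV_domain)
  then show ?thesis by (simp only: measurable_cong_sets[OF refl sets_PiM_equal_borel])
qed

lemma has_sum_circle:
  assumes "d \<in> full_3_shift"
  shows "((\<lambda>t. int_scale (d t) (x_delta (- t + s))) has_sum homoclinic_map d s) UNIV"
proof -
  have "((circle_of \<circ> (\<lambda>t. of_int (d t) * w_delta (- t + s))) has_sum circle_of (real_lift d s)) UNIV"
  proof (rule has_sum_comm_additive[OF _ _ real_lift_has_sum[OF assms]])
    show "Modules.additive circle_of" by (simp add: Modules.additive_def circle_of_hom(1))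
    show "circle_of \<midarrow>real_lift d s\<rightarrow> circle_of (real_lift d s)"
      using continuous_circle_of by (simp add: continuous_on_def)
  qed
  moreover have "circle_of \<circ> (\<lambda>t. of_int (d t) * w_delta (- t + s)) =
      (\<lambda>t. int_scale (d t) (x_delta (- t + s)))"
    by (simp only: o_def x_delta_def circle_of_hom(4))
  ultimately show ?thesis by (simp only: homoclinic_map_eq)
qed

lemma homoclinic_map_eq_rmul:
  assumes "d \<in> full_3_shift"
  shows "homoclinic_map d = rmul int_scale d x_delta"
proof
  show "homoclinic_map d s = rmul int_scale d x_delta s" for s
    unfolding rmul_def by (rule infsumI[OF has_sum_circle[OF assms], symmetric])
qed

section \<open>Equivariance and the range\<close>

lemma left_shift_full_3_shift: "d \<in> full_3_shift \<Longrightarrow> left_shift s d \<in> full_3_shift"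
  by (simp add: full_3_shift_def left_shift_def)

lemma iterated_lift_left_shift: "iterated_lift n (left_shift s d) t = iterated_lift n d (- s + t)"
  by (induction n arbitrary: t) (simp_all add: left_shift_def add.assoc)

lemma homoclinic_map_left_shift:
  assumes "d \<in> full_3_shift"
  shows "homoclinic_map (left_shift s d) = left_shift s (homoclinic_map d)"
proof
  fix t
  have "real_lift (left_shift s d) t = real_lift d (- s + t)"
    using iterated_lift_tendsto[OF left_shift_full_3_shift[OF assms], of s t]
      iterated_lift_tendsto[OF assms, of "- s + t"]
    by (simp add: iterated_lift_left_shift LIMSEQ_unique)
  then show "homoclinic_map (left_shift s d) t = left_shift s (homoclinic_map d) t"
    by (simp add: homoclinic_map_eq left_shift_def)
qed

lemma mem_principal_space_f_ab_iff:
  "x \<in> principal_space f_ab \<longleftrightarrow> (\<forall>t. int_scale 3 (x t) = x (t + gen_a) + x (t + gen_b))"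
proof -
  have coeff: "coeff f_ab s = (if s = 0 then 3 else if s = gen_a \<or> s = gen_b then - 1 else 0)" for s
    using coeff_star_f_ab[of "- s"]
    by (simp only: coeff_star minus_minus neg_equal_iff_equal neg_equal_0_iff_equal)
  have "s \<in> supp f_ab \<longleftrightarrow> s \<in> {0, gen_a, gen_b}" for s
    by (simp add: in_keys_iff coeff)
  then have "supp f_ab = {0, gen_a, gen_b}" by blast
  moreover have "int_scale (- 1) u = - u" for u by transfer simp
  ultimately have "x \<in> principal_space f_ab \<longleftrightarrow>
      (\<forall>t. int_scale 3 (x t) + (- x (t + gen_a) + - x (t + gen_b)) = 0)"
    using gens_neq by (simp add: mem_principal_space_iff coeff)
  also have "\<dots> \<longleftrightarrow> (\<forall>t. int_scale 3 (x t) = x (t + gen_a) + x (t + gen_b))"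
    by (simp only: eq_neg_iff_add_eq_0[symmetric] minus_add_distrib minus_minus)
  finally show ?thesis .
qed

lemma homoclinic_map_in_principal_space:
  assumes "d \<in> full_3_shift"
  shows "homoclinic_map d \<in> principal_space f_ab"
  unfolding mem_principal_space_f_ab_iff
proof
  fix t
  have "circle_of (3 * real_lift d t) =
      circle_of (real_lift d (t + gen_a) + real_lift d (t + gen_b))"
  proof -
    have "3 * real_lift d t - (real_lift d (t + gen_a) + real_lift d (t + gen_b)) = of_int (d t)"
      using real_lift_recursion[OF assms, of t] by linarith
    then show ?thesis by (simp only: circle_of_eq_iff Ints_of_int)
  qed
  then show "int_scale 3 (homoclinic_map d t) = homoclinic_map d (t + gen_a) + homoclinic_map d (t + gen_b)"
    by (simp only: homoclinic_map_eq circle_of_hom(1,4) of_int_numeral)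
qed

lemma int_scale_add: "int_scale n (u + v) = int_scale n u + int_scale n v"
  and int_scale_minus: "int_scale n (- u) = - int_scale n u"
  by (transfer; simp add: distrib_left)+

lemma principal_space_f_ab_closed:
  "x \<in> principal_space f_ab \<Longrightarrow> - x \<in> principal_space f_ab"
  "x \<in> principal_space f_ab \<Longrightarrow> y \<in> principal_space f_ab \<Longrightarrow> x + y \<in> principal_space f_ab"
  unfolding mem_principal_space_f_ab_iff plus_fun_apply fun_Compl_def int_scale_add int_scale_minus
  by (simp_all only: minus_add_distrib) (simp_all add: ac_simps)

section \<open>Approximate translations of the shift\<close>

definition height :: "free2 \<Rightarrow> int" where
  "height = (THE h. (\<forall>s t. h (s + t) = h s + h t) \<and> h gen_a = 1 \<and> h gen_b = 1)"

lemma height_hom: "height (s + t) = height s + height t"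
  and height_gens [simp]: "height gen_a = 1" "height gen_b = 1"
  using theI'[OF free2_universal[of "1 :: int" 1]] by (simp_all add: height_def)

lemma height_zero: "height 0 = 0"
  using height_hom[of 0 0] by simp

lemma height_minus: "height (- s) = - height s"
  using height_hom[of "- s" s] height_zero by simp

lemma height_neg_words: "s \<in> neg_words \<Longrightarrow> height s \<le> 0"
  by (induction rule: neg_words.induct) (simp_all add: height_zero height_hom height_minus)

text \<open>The support of \<open>w\<^sup>\<Delta>\<close> lies in heights \<open>\<le> 0\<close>, so the lift at \<open>s\<close> only sees \<open>s\<close> and larger heights.\<close>

lemma real_lift_cong:
  assumes "\<And>t. height s \<le> height t \<Longrightarrow> d t = d' t"
  shows "real_lift d s = real_lift d' s"
  unfolding real_lift_def rmul_def
proof (rule infsum_cong)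
  fix t
  show "of_int (d t) * w_delta (- t + s) = of_int (d' t) * w_delta (- t + s)"
  proof (cases "- t + s \<in> neg_words")
    case True
    then have "height s \<le> height t"
      using height_neg_words[OF True] by (simp add: height_hom height_minus)
    then show ?thesis by (simp add: assms)
  qed (simp add: w_delta_def)
qed

text \<open>Here \<open>z\<close> lifts the point \<open>x\<close> of \<open>X\<^sub>f\<close> that is added, and \<open>p\<close> is a lift of \<open>x + \<phi>(d)\<close> at the two
  children of \<open>s\<close>.  The number under the floor is then an integer, and \<open>d\<^sub>s\<close> plus this integer is the new
  digit at \<open>s\<close> modulo \<open>3\<close>.\<close>

definition carry :: "(free2 \<Rightarrow> real) \<Rightarrow> (free2 \<Rightarrow> int) \<Rightarrow> (free2 \<Rightarrow> real) \<Rightarrow> free2 \<Rightarrow> int" where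
  "carry z d p s = \<lfloor>3 * z s + (real_lift d (s + gen_a) + real_lift d (s + gen_b)) -
     (p (s + gen_a) + p (s + gen_b))\<rfloor>"

text \<open>The lift of \<open>x + \<phi>(d)\<close> at \<open>s\<close> that results when fractional parts are prescribed at the descendants of
  generation \<open>k\<close> and digits are computed from there back to \<open>s\<close>.\<close>

primrec shifted_lift :: "(free2 \<Rightarrow> real) \<Rightarrow> nat \<Rightarrow> (free2 \<Rightarrow> int) \<Rightarrow> free2 \<Rightarrow> real" where
  "shifted_lift z 0 d s = frac (real_lift d s + z s)"
| "shifted_lift z (Suc k) d s = (of_int ((d s + carry z d (shifted_lift z k d) s) mod 3) +
     shifted_lift z k d (s + gen_a) + shifted_lift z k d (s + gen_b)) / 3"

lemma mod_3_bounds: "0 \<le> (x :: int) mod 3" "x mod 3 \<le> 2"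
  by simp_all

lemma shifted_lift_bounds: "0 \<le> shifted_lift z k d s \<and> shifted_lift z k d s \<le> 2"
proof (induction k arbitrary: s)
  case 0
  have "frac (real_lift d s + z s) \<le> 1" by (rule less_imp_le[OF frac_lt_1])
  then show ?case by simp
next
  case (Suc k)
  define m where "m = (d s + carry z d (shifted_lift z k d) s) mod 3"
  have "0 \<le> m" "m \<le> 2" unfolding m_def by (rule mod_3_bounds)+
  then show ?case
    using Suc[of "s + gen_a"] Suc[of "s + gen_b"] unfolding shifted_lift.simps m_def[symmetric] by simp
qed

text \<open>One step of addition with carry: the new value differs from \<open>v + z\<close> by the integer that is discarded
  when the digit is reduced modulo \<open>3\<close>.\<close>

lemma carry_exact:
  fixes v va vb z za zb pa pb :: real and x :: int
  assumes "3 * v - va - vb = of_int x" "3 * z - za - zb \<in> \<int>"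
    and "pa - (va + za) \<in> \<int>" "pb - (vb + zb) \<in> \<int>"
  shows "(of_int ((x + \<lfloor>3 * z + (va + vb) - (pa + pb)\<rfloor>) mod 3) + pa + pb) / 3 - (v + z) \<in> \<int>"
proof -
  define c where "c = \<lfloor>3 * z + (va + vb) - (pa + pb)\<rfloor>"
  have "3 * z + (va + vb) - (pa + pb) = (3 * z - za - zb) - (pa - (va + za)) - (pb - (vb + zb))"
    by (simp add: algebra_simps)
  also have "\<dots> \<in> \<int>" by (intro Ints_diff assms)
  finally have c: "of_int c = 3 * z + (va + vb) - (pa + pb)"
    unfolding c_def by (simp only: floor_of_int of_int_floor_cancel Ints_cases) (metis Ints_cases floor_of_int)
  have "3 * ((of_int ((x + c) mod 3) + pa + pb) / 3 - (v + z)) = of_int ((x + c) mod 3) - of_int (x + c)"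
  proof -
    have "3 * (q / 3 - w) = q - 3 * w" for q w :: real by (simp add: right_diff_distrib)
    from this[of "of_int ((x + c) mod 3) + pa + pb" "v + z"] show ?thesis
      using assms(1) c by (simp only: of_int_add distrib_left)
  qed
  also have "\<dots> = 3 * of_int (- ((x + c) div 3))"
    unfolding of_int_diff[symmetric] by (simp add: minus_mult_div_eq_mod[symmetric])
  finally have "(of_int ((x + c) mod 3) + pa + pb) / 3 - (v + z) = of_int (- ((x + c) div 3))"
    by (simp only: mult_cancel_left) simp
  then show ?thesis unfolding c_def by (metis Ints_of_int)
qed

lemma shifted_lift_congruent:
  assumes d: "d \<in> full_3_shift" and z: "\<And>s. 3 * z s - z (s + gen_a) - z (s + gen_b) \<in> \<int>"
  shows "shifted_lift z k d s - (real_lift d s + z s) \<in> \<int>"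
proof (induction k arbitrary: s)
  case 0
  show ?case by (simp add: frac_def)
next
  case (Suc k)
  show ?case
    unfolding shifted_lift.simps carry_def
    by (rule carry_exact[OF real_lift_recursion[OF d] z Suc Suc])
qed

lemma shifted_lift_cong:
  assumes "\<And>t. height s \<le> height t \<Longrightarrow> d t = d' t"
  shows "shifted_lift z k d s = shifted_lift z k d' s"
  using assms
proof (induction k arbitrary: s)
  case 0
  then show ?case using real_lift_cong[of s d d'] by simp
next
  case (Suc k)
  have "shifted_lift z k d (s + c) = shifted_lift z k d' (s + c)"
    "real_lift d (s + c) = real_lift d' (s + c)" if "c \<in> {gen_a, gen_b}" for c
    using that Suc.prems by (auto intro!: Suc.IH real_lift_cong simp: height_hom)
  then show ?case using Suc.prems[of s] by (simp add: carry_def)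
qed

lemma measurable_carry:
  assumes [measurable]: "\<And>s. (\<lambda>d. p d s) \<in> borel_measurable \<nu>"
  shows "(\<lambda>d. carry z d (p d) s) \<in> \<nu> \<rightarrow>\<^sub>M count_space UNIV"
  unfolding carry_def by measurable

lemma measurable_shifted_lift: "(\<lambda>d. shifted_lift z k d s) \<in> borel_measurable \<nu>"
proof (induction k arbitrary: s)
  case 0
  show ?case unfolding shifted_lift.simps frac_def by measurable
next
  case (Suc k)
  note [measurable] = Suc measurable_carry[OF Suc]
  have [measurable]: "(\<lambda>d. real_of_int ((d s + carry z d (shifted_lift z k d) s) mod 3)) \<in> borel_measurable \<nu>"
    by (rule measurable_compose[OF measurable_add_mod_3]) measurable
  show ?case unfolding shifted_lift.simps by measurable
qed

text \<open>The prescribed values sit at height \<open>n\<close>.  The children of \<open>s\<close> have height \<open>height s + 1\<close>, hence are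
  \<open>n - 1 - height s\<close> generations away from it.\<close>

definition digit_shift :: "(free2 \<Rightarrow> real) \<Rightarrow> nat \<Rightarrow> free2 \<Rightarrow> (free2 \<Rightarrow> int) \<Rightarrow> int" where
  "digit_shift z n s d = carry z d (shifted_lift z (nat (int n - 1 - height s)) d) s"

definition approx_translation :: "(free2 \<Rightarrow> real) \<Rightarrow> nat \<Rightarrow> (free2 \<Rightarrow> int) \<Rightarrow> free2 \<Rightarrow> int" where
  "approx_translation z n = twist (digit_shift z n) {s. height s < int n}"

lemma measurable_digit_shift: "digit_shift z n s \<in> \<nu> \<rightarrow>\<^sub>M count_space UNIV"
  using measurable_carry[OF measurable_shifted_lift] by (simp add: digit_shift_def[abs_def])

lemma approx_translation_measurable: "approx_translation z n \<in> \<nu> \<rightarrow>\<^sub>M \<nu>"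
  unfolding approx_translation_def by (rule measurable_twist[OF measurable_digit_shift])

lemma approx_translation_full_3_shift:
  "d \<in> full_3_shift \<Longrightarrow> approx_translation z n d \<in> full_3_shift"
  using measurable_space[OF approx_translation_measurable] by (simp add: space_full_3_shift_measure)

lemma distr_approx_translation: "distr \<nu> \<nu> (approx_translation z n) = \<nu>"
  unfolding approx_translation_def
proof (rule distr_twist[OF measurable_digit_shift, where h = height])
  fix s t d x assume st: "height s \<le> height t"
  have "shifted_lift z k (d(s := x)) (t + c) = shifted_lift z k d (t + c)"
    "real_lift (d(s := x)) (t + c) = real_lift d (t + c)" if "c \<in> {gen_a, gen_b}" for c k
    using that st by (auto intro!: shifted_lift_cong real_lift_cong simp: height_hom)
  then show "digit_shift z n t (d(s := x)) = digit_shift z n t d"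
    by (simp add: digit_shift_def carry_def)
qed

text \<open>Below height \<open>n\<close> the new digits and the shifted lift satisfy the same recursion as the real lift of
  the new digits; at height \<open>n\<close> both are in \<open>[0, 2]\<close>.\<close>

lemma approx_translation_error:
  assumes d: "d \<in> full_3_shift" and s: "height s \<le> int n"
  shows "\<bar>real_lift (approx_translation z n d) s - shifted_lift z (nat (int n - height s)) d s\<bar>
    \<le> 2 * (2/3) ^ nat (int n - height s)"
proof -
  let ?d = "approx_translation z n d"
  note d' = approx_translation_full_3_shift[OF d, of z n]
  \<comment> \<open>The lift for \<open>k\<close> generations is relevant only at height \<open>n - k\<close>; elsewhere the error is set to \<open>0\<close>
    so that the contraction estimate applies to all of the group.\<close>
  define e where "e k s = (if height s + int k = int n then real_lift ?d s - shifted_lift z k d s else 0)" for k s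
  have "\<bar>e k s\<bar> \<le> 2 * (2/3) ^ k" for k s
  proof (rule contraction)
    show "\<bar>e 0 s\<bar> \<le> 2" for s
    proof -
      have "\<bar>v - p\<bar> \<le> 2" if "0 \<le> v" "v \<le> 2" "0 \<le> p \<and> p \<le> 2" for v p :: real
        using that by linarith
      from this[OF real_lift_bounds[OF d', of s] shifted_lift_bounds[of z 0 d s]]
      show ?thesis unfolding e_def by (simp del: shifted_lift.simps)
    qed
    show "\<bar>e (Suc k) s\<bar> \<le> (\<bar>e k (s + gen_a)\<bar> + \<bar>e k (s + gen_b)\<bar>) / 3" for k s
    proof (cases "height s + int (Suc k) = int n")
      case True
      have ab: "e k (s + gen_a) = real_lift ?d (s + gen_a) - shifted_lift z k d (s + gen_a)"
          "e k (s + gen_b) = real_lift ?d (s + gen_b) - shifted_lift z k d (s + gen_b)"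
        using True by (simp_all add: e_def height_hom)
      have k: "nat (int n - 1 - height s) = k" and "height s < int n" using True by simp_all
      then have "?d s = (d s + carry z d (shifted_lift z k d) s) mod 3"
        by (simp add: approx_translation_def twist_def digit_shift_def)
      then have step: "shifted_lift z (Suc k) d s =
          (of_int (?d s) + shifted_lift z k d (s + gen_a) + shifted_lift z k d (s + gen_b)) / 3"
        by simp
      have "e (Suc k) s = real_lift ?d s - shifted_lift z (Suc k) d s"
        unfolding e_def by (rule if_P[OF True])
      then have "3 * e (Suc k) s = e k (s + gen_a) + e k (s + gen_b)"
        unfolding ab using recursion_diff[OF real_lift_recursion[OF d', of s] step] by (simp only:)
      then show ?thesis by (rule abs_third)
    next
      case False
      then have "e (Suc k) s = 0" by (simp only: e_def if_False)
      then show ?thesis by simp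
    qed
  qed
  from this[of "nat (int n - height s)" s] show ?thesis using s by (simp add: e_def)
qed

lemma approx_translation_tendsto:
  assumes d: "d \<in> full_3_shift" and z: "\<And>s. 3 * z s - z (s + gen_a) - z (s + gen_b) \<in> \<int>"
  shows "(\<lambda>n. homoclinic_map (approx_translation z n d) s) \<longlonglongrightarrow> circle_of (real_lift d s + z s)"
proof -
  let ?v = "\<lambda>n. real_lift (approx_translation z n d) s"
  let ?p = "\<lambda>n. shifted_lift z (nat (int n - height s)) d s"
  have "(\<lambda>n. ?v n - ?p n) \<longlonglongrightarrow> 0"
  proof (rule Lim_null_comparison)
    show "\<forall>\<^sub>F n in sequentially. norm (?v n - ?p n) \<le> 2 * (2/3) ^ nat (int n - height s)"
      using eventually_ge_at_top[of "nat (height s)"]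
    proof eventually_elim
      case (elim n)
      then show ?case unfolding real_norm_def by (intro approx_translation_error[OF d]) simp
    qed
    have "filterlim (\<lambda>n. nat (int n - height s)) sequentially sequentially"
      unfolding filterlim_at_top
    proof
      fix m
      show "\<forall>\<^sub>F n in sequentially. m \<le> nat (int n - height s)"
        using eventually_ge_at_top[of "nat (int m + height s)"] by eventually_elim simp
    qed
    from filterlim_compose[OF power_two_thirds_tendsto_0 this, of 2]
    show "(\<lambda>n. 2 * (2/3 :: real) ^ nat (int n - height s)) \<longlonglongrightarrow> 0" .
  qed
  from tendsto_add[OF this tendsto_const[of "real_lift d s + z s"]]
  have "(\<lambda>n. ?v n - ?p n + (real_lift d s + z s)) \<longlonglongrightarrow> real_lift d s + z s" by simp
  moreover have "isCont circle_of x" for x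
    using continuous_circle_of by (simp add: continuous_on_eq_continuous_at)
  ultimately have "(\<lambda>n. circle_of (?v n - ?p n + (real_lift d s + z s))) \<longlonglongrightarrow> circle_of (real_lift d s + z s)"
    by (rule isCont_tendsto_compose[rotated])
  moreover have "circle_of (?v n - ?p n + (real_lift d s + z s)) = homoclinic_map (approx_translation z n d) s" for n
  proof -
    have "circle_of (?p n) = circle_of (real_lift d s + z s)"
      using shifted_lift_congruent[OF d z] by (simp only: circle_of_eq_iff)
    then show ?thesis by (simp add: circle_of_hom(1,2) homoclinic_map_eq)
  qed
  ultimately show ?thesis by (simp only:)
qed

lemma translation_lift:
  assumes "x \<in> principal_space f_ab"
  obtains z where "\<And>s. circle_of (z s) = x s" "\<And>s. 3 * z s - z (s + gen_a) - z (s + gen_b) \<in> \<int>"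
proof -
  obtain z where z: "\<And>s. circle_of (z s) = x s"
    using choice[of "\<lambda>s r. circle_of r = x s"] circle_of_surj by blast
  have "circle_of (3 * z s) = circle_of (z (s + gen_a) + z (s + gen_b))" for s
  proof -
    have "int_scale 3 (x s) = x (s + gen_a) + x (s + gen_b)" using assms mem_principal_space_f_ab_iff by blast
    then show ?thesis unfolding z[symmetric] by (simp add: circle_of_hom(1,4))
  qed
  then have "3 * z s - z (s + gen_a) - z (s + gen_b) \<in> \<int>" for s
    unfolding circle_of_eq_iff by (simp only: diff_diff_eq)
  with z show thesis by (rule that)
qed

text \<open>Translations of \<open>X\<^sub>f\<close> by one of its points are pointwise limits, through the homoclinic map, of
  measure-preserving maps of the shift.\<close>

lemma translation_is_limit:
  assumes "x \<in> principal_space f_ab"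
  obtains T where "\<And>n. T n \<in> \<nu> \<rightarrow>\<^sub>M \<nu>" "\<And>n. distr \<nu> \<nu> (T n) = \<nu>"
    "\<And>d. d \<in> full_3_shift \<Longrightarrow> (\<lambda>n. homoclinic_map (T n d)) \<longlonglongrightarrow> x + homoclinic_map d"
proof -
  obtain z where z: "\<And>s. circle_of (z s) = x s" "\<And>s. 3 * z s - z (s + gen_a) - z (s + gen_b) \<in> \<int>"
    using translation_lift[OF assms] by metis
  have "(\<lambda>n. homoclinic_map (approx_translation z n d)) \<longlonglongrightarrow> x + homoclinic_map d"
    if "d \<in> full_3_shift" for d
  proof -
    have "(\<lambda>n. homoclinic_map (approx_translation z n d) s) \<longlonglongrightarrow> (x + homoclinic_map d) s" for s
      using approx_translation_tendsto[OF that z(2), of s]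
      by (simp add: circle_of_hom(1) z(1) homoclinic_map_eq add.commute)
    then have "limitin (product_topology (\<lambda>_. euclidean) UNIV)
        (\<lambda>n. homoclinic_map (approx_translation z n d)) (x + homoclinic_map d) sequentially"
      by (simp add: limitin_componentwise)
    then show ?thesis by (simp add: euclidean_product_topology)
  qed
  then show thesis
    by (rule that[OF approx_translation_measurable distr_approx_translation])
qed

section \<open>Surjectivity and Haar measure\<close>

lemma compact_full_3_shift: "compact full_3_shift"
proof -
  have "full_3_shift = (\<Pi>\<^sub>E s\<in>UNIV. {0, 1, 2})" by (auto simp: full_3_shift_def PiE_UNIV_domain)
  moreover have "compactin (product_topology (\<lambda>_ :: free2. euclidean) UNIV) (\<Pi>\<^sub>E s\<in>UNIV. {0, 1, 2 :: int})"
    unfolding compactin_PiE by (auto simp: finite_imp_compact)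
  ultimately show ?thesis by (simp add: euclidean_product_topology)
qed

lemma closed_homoclinic_image:
  assumes "closed C"
  shows "closed (homoclinic_map ` (full_3_shift \<inter> C))"
proof -
  have "compact (homoclinic_map ` (full_3_shift \<inter> C))"
    using compact_full_3_shift assms
    by (intro compact_continuous_image continuous_on_subset[OF continuous_homoclinic_map] compact_Int_closed) auto
  then have "compactin (product_topology (\<lambda>_. euclidean) UNIV) (homoclinic_map ` (full_3_shift \<inter> C))"
    by (simp add: euclidean_product_topology)
  moreover have "Hausdorff_space (euclidean :: circle topology)"
    unfolding Hausdorff_space_def disjnt_def using hausdorff by (simp, blast)
  then have "Hausdorff_space (product_topology (\<lambda>_ :: free2. euclidean :: circle topology) UNIV)"
    by (simp add: Hausdorff_space_product_topology)
  ultimately have "closedin (product_topology (\<lambda>_. euclidean) UNIV) (homoclinic_map ` (full_3_shift \<inter> C))"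
    by (rule compactin_imp_closedin[rotated])
  then show ?thesis by (simp add: euclidean_product_topology)
qed

text \<open>Every point is a limit of points of the compact image, reached by translating any one of its points.\<close>

lemma homoclinic_map_surj: "homoclinic_map ` full_3_shift = principal_space f_ab"
proof
  show "homoclinic_map ` full_3_shift \<subseteq> principal_space f_ab"
    using homoclinic_map_in_principal_space by blast
  show "principal_space f_ab \<subseteq> homoclinic_map ` full_3_shift"
  proof
    fix x assume x: "x \<in> principal_space f_ab"
    define d :: "free2 \<Rightarrow> int" where "d = (\<lambda>_. 0)"
    have d: "d \<in> full_3_shift" by (simp add: d_def full_3_shift_def)
    have "x + - homoclinic_map d \<in> principal_space f_ab"
      by (intro principal_space_f_ab_closed x homoclinic_map_in_principal_space d)
    then obtain T where T: "\<And>n. T n \<in> \<nu> \<rightarrow>\<^sub>M \<nu>"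
        "(\<lambda>n. homoclinic_map (T n d)) \<longlonglongrightarrow> x + - homoclinic_map d + homoclinic_map d"
      using translation_is_limit d by metis
    have "T n d \<in> full_3_shift" for n
      using measurable_space[OF T(1)] d by (simp add: space_full_3_shift_measure)
    moreover have "closed (homoclinic_map ` full_3_shift)"
      using closed_homoclinic_image[of UNIV] by simp
    ultimately have "x + - homoclinic_map d + homoclinic_map d \<in> homoclinic_map ` full_3_shift"
      using T(2) by (intro Lim_in_closed_set[of _ "\<lambda>n. homoclinic_map (T n d)" sequentially]) auto
    then show "x \<in> homoclinic_map ` full_3_shift" by simp
  qed
qed

text \<open>If \<open>T\<^sub>n d\<close> is distributed like \<open>d\<close> and its image tends to \<open>x + \<phi> d\<close>, Fatou's lemma bounds the law of
  \<open>x + \<phi> d\<close> by the law of \<open>\<phi> d\<close> on open sets; the reverse bound is the same statement for \<open>- x\<close>.\<close>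

lemma translated_law_le:
  assumes x: "x \<in> principal_space f_ab" and G: "open G"
  shows "emeasure \<nu> {d \<in> space \<nu>. x + homoclinic_map d \<in> G} \<le> emeasure \<nu> {d \<in> space \<nu>. homoclinic_map d \<in> G}"
proof -
  note [measurable] = measurable_homoclinic_map
  have Gb [measurable]: "G \<in> sets borel" using G by simp
  obtain T where T: "\<And>n. T n \<in> \<nu> \<rightarrow>\<^sub>M \<nu>" "\<And>n. distr \<nu> \<nu> (T n) = \<nu>"
    "\<And>d. d \<in> full_3_shift \<Longrightarrow> (\<lambda>n. homoclinic_map (T n d)) \<longlonglongrightarrow> x + homoclinic_map d"
    using translation_is_limit[OF x] by metis
  note [measurable] = T(1)
  define A where "A = {d \<in> space \<nu>. homoclinic_map d \<in> G}"
  define B where "B m = {d \<in> space \<nu>. \<forall>n\<ge>m. homoclinic_map (T n d) \<in> G}" for m :: nat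
  have A: "A \<in> sets \<nu>" unfolding A_def by measurable
  have B: "B m \<in> sets \<nu>" for m unfolding B_def by measurable
  have "{d \<in> space \<nu>. x + homoclinic_map d \<in> G} \<subseteq> (\<Union>m. B m)"
  proof
    fix d assume d: "d \<in> {d \<in> space \<nu>. x + homoclinic_map d \<in> G}"
    then have "\<forall>\<^sub>F n in sequentially. homoclinic_map (T n d) \<in> G"
      using T(3)[of d] G by (intro topological_tendstoD) (auto simp: space_full_3_shift_measure)
    with d show "d \<in> (\<Union>m. B m)" by (auto simp: B_def eventually_sequentially)
  qed
  then have "emeasure \<nu> {d \<in> space \<nu>. x + homoclinic_map d \<in> G} \<le> emeasure \<nu> (\<Union>m. B m)"
    using B by (intro emeasure_mono) auto
  also have "\<dots> = (SUP m. emeasure \<nu> (B m))"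
    using B by (intro SUP_emeasure_incseq[symmetric]) (auto simp: incseq_def B_def)
  also have "\<dots> \<le> emeasure \<nu> A"
  proof (rule SUP_least)
    fix m
    have "emeasure \<nu> (B m) \<le> emeasure \<nu> (T m -` A \<inter> space \<nu>)"
      using measurable_sets[OF T(1) A, of m] measurable_space[OF T(1)]
      by (intro emeasure_mono) (auto simp: A_def B_def)
    also have "\<dots> = emeasure \<nu> A"
      using emeasure_distr[OF T(1) A, of m] by (simp add: T(2))
    finally show "emeasure \<nu> (B m) \<le> emeasure \<nu> A" .
  qed
  finally show ?thesis unfolding A_def .
qed

lemma translated_law_open:
  assumes x: "x \<in> principal_space f_ab" and G: "open G"
  shows "emeasure \<nu> {d \<in> space \<nu>. x + homoclinic_map d \<in> G} = emeasure \<nu> {d \<in> space \<nu>. homoclinic_map d \<in> G}"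
proof (rule antisym[OF translated_law_le[OF assms]])
  have "open ((+) x -` G)"
    using open_vimage[OF G continuous_translation] .
  from translated_law_le[OF principal_space_f_ab_closed(1)[OF x] this]
  show "emeasure \<nu> {d \<in> space \<nu>. homoclinic_map d \<in> G} \<le> emeasure \<nu> {d \<in> space \<nu>. x + homoclinic_map d \<in> G}"
    by (simp only: vimage_eq add_minus_cancel)
qed

lemma measurable_translated_homoclinic_map: "(\<lambda>d. x + homoclinic_map d) \<in> \<nu> \<rightarrow>\<^sub>M borel"
  by (rule measurable_compose[OF measurable_homoclinic_map borel_measurable_continuous_onI[OF continuous_translation]])

lemma translated_law:
  assumes x: "x \<in> principal_space f_ab"
  shows "distr \<nu> borel (\<lambda>d. x + homoclinic_map d) = distr \<nu> borel homoclinic_map"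
proof (rule measure_eqI_generator_eq[where E = "{G. open G}" and \<Omega> = UNIV and A = "\<lambda>_. UNIV"])
  show "Int_stable {G :: (free2 \<Rightarrow> circle) set. open G}" by (auto simp: Int_stable_def)
  show "emeasure (distr \<nu> borel (\<lambda>d. x + homoclinic_map d)) G = emeasure (distr \<nu> borel homoclinic_map) G"
    if "G \<in> {G. open G}" for G
    using translated_law_open[OF x, of G] that
    by (simp add: emeasure_distr measurable_homoclinic_map measurable_translated_homoclinic_map
        vimage_def Int_def conj_commute)
  show "emeasure (distr \<nu> borel (\<lambda>d. x + homoclinic_map d)) UNIV \<noteq> \<infinity>"
    using prob_space.emeasure_space_1[OF nu.prob_space_distr[OF measurable_translated_homoclinic_map, of x]] by simp
qed (auto simp: sets_borel)

lemma measurable_homoclinic_map_principal_space: "homoclinic_map \<in> \<nu> \<rightarrow>\<^sub>M restrict_space borel (principal_space f_ab)"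
  by (intro measurable_restrict_space2 measurable_homoclinic_map)
    (auto simp: space_full_3_shift_measure homoclinic_map_in_principal_space)

lemma haar_homoclinic_law:
  "is_normalized_haar (principal_space f_ab)
     (distr \<nu> (restrict_space borel (principal_space f_ab)) homoclinic_map)"
  unfolding is_normalized_haar_def
proof (intro conjI ballI)
  let ?X = "principal_space f_ab"
  let ?M = "distr \<nu> (restrict_space borel ?X) homoclinic_map"
  show "sets ?M = sets (restrict_space borel ?X)" by simp
  show "prob_space ?M" by (rule nu.prob_space_distr[OF measurable_homoclinic_map_principal_space])
  fix x E assume x: "x \<in> ?X" and "E \<in> sets ?M"
  then obtain F where F: "F \<in> sets borel" "E = F \<inter> ?X"
    by (auto simp: sets_restrict_space)
  have law: "emeasure ?M (H \<inter> ?X) = emeasure (distr \<nu> borel homoclinic_map) H" if "H \<in> sets borel" for H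
  proof -
    have "homoclinic_map -` (H \<inter> ?X) \<inter> space \<nu> = homoclinic_map -` H \<inter> space \<nu>"
      by (auto simp: space_full_3_shift_measure homoclinic_map_in_principal_space)
    moreover have "H \<inter> ?X \<in> sets (restrict_space borel ?X)" using that by (auto simp: sets_restrict_space)
    ultimately show ?thesis
      using that by (simp add: emeasure_distr measurable_homoclinic_map measurable_homoclinic_map_principal_space)
  qed
  have vim: "(+) (- x) -` F \<in> sets borel"
    using measurable_sets[OF borel_measurable_continuous_onI[OF continuous_translation[of "- x"]] F(1)] by simp
  have "(+) x ` E = ((+) (- x) -` F) \<inter> ?X"
  proof (intro set_eqI iffI)
    fix y assume "y \<in> (+) x ` E"
    then show "y \<in> ((+) (- x) -` F) \<inter> ?X" using principal_space_f_ab_closed(2)[OF x] by (auto simp: F(2))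
  next
    fix y assume y: "y \<in> ((+) (- x) -` F) \<inter> ?X"
    then have "- x + y \<in> E" using principal_space_f_ab_closed(2)[OF principal_space_f_ab_closed(1)[OF x], of y] by (simp only: F(2)) blast
    then show "y \<in> (+) x ` E" by (intro image_eqI[of _ _ "- x + y"]) (simp_all only: add_minus_cancel)
  qed
  then have "emeasure ?M ((+) x ` E) = emeasure (distr \<nu> borel homoclinic_map) ((+) (- x) -` F)"
    by (simp only: law[OF vim])
  also have "\<dots> = emeasure (distr \<nu> borel (\<lambda>d. - x + homoclinic_map d)) F"
    using vim F(1) unfolding emeasure_distr[OF measurable_homoclinic_map vim]
      emeasure_distr[OF measurable_translated_homoclinic_map F(1)] by (simp only: vimage_def mem_Collect_eq)
  also have "\<dots> = emeasure ?M E"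
    unfolding translated_law[OF principal_space_f_ab_closed(1)[OF x]] F(2) by (rule law[OF F(1), symmetric])
  finally show "emeasure ?M ((+) x ` E) = emeasure ?M E" .
qed

lemma normalized_haar_eq_homoclinic_law:
  "normalized_haar (principal_space f_ab) =
     distr \<nu> (restrict_space borel (principal_space f_ab)) homoclinic_map"
  using principal_space_f_ab_closed haar_homoclinic_law by (intro normalized_haar_eqI) blast+

section \<open>Injectivity off a null set\<close>

text \<open>From \<open>s\<close> there is a tree of descendants of \<open>n\<close> generations in which a digit \<open>1\<close> has both children, a
  digit \<open>p\<close> at least one, and the third digit does not occur.  The value \<open>p = 2\<close> describes the larger and
  \<open>p = 0\<close> the smaller of two configurations with the same image.\<close>

primrec survives :: "int \<Rightarrow> nat \<Rightarrow> free2 \<Rightarrow> (free2 \<Rightarrow> int) \<Rightarrow> bool" where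
  "survives p 0 s d = True"
| "survives p (Suc n) s d =
     ((d s = 1 \<and> survives p n (s + gen_a) d \<and> survives p n (s + gen_b) d) \<or>
      (d s = p \<and> (survives p n (s + gen_a) d \<or> survives p n (s + gen_b) d)))"

definition ambiguous :: "(free2 \<Rightarrow> int) set" where
  "ambiguous = {d \<in> full_3_shift. \<exists>s. (\<forall>n. survives 2 n s d) \<or> (\<forall>n. survives 0 n s d)}"

lemma measurable_survives [measurable]: "Measurable.pred \<nu> (survives p n s)"
proof (induction n arbitrary: s)
  case 0
  have "survives p 0 s = (\<lambda>_. True)" by (simp add: fun_eq_iff)
  then show ?case by simp
next
  case (Suc n)
  note [measurable] = Suc
  show ?case unfolding survives.simps by measurable
qed

lemma survives_cong:
  assumes "\<And>t. height s \<le> height t \<Longrightarrow> d t = d' t"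
  shows "survives p n s d = survives p n s d'"
  using assms
proof (induction n arbitrary: s)
  case (Suc n)
  have "survives p n (s + c) d = survives p n (s + c) d'" if "c \<in> {gen_a, gen_b}" for c
    using that Suc.prems by (auto intro!: Suc.IH simp: height_hom)
  then show ?case using Suc.prems[of s] by simp
qed simp

text \<open>Rotating coordinate \<open>s\<close> permutes the three events cyclically, so they have equal probability.\<close>

lemma prob_digit_independent:
  assumes R [measurable]: "Measurable.pred \<nu> R" and indep: "\<And>d x. R (d(s := x)) = R d"
    and j: "j \<in> {0, 1, 2}"
  shows "nu.prob {d \<in> space \<nu>. d s = j \<and> R d} = nu.prob {d \<in> space \<nu>. R d} / 3"
proof -
  have rotate: "nu.prob {d \<in> space \<nu>. d s = j \<and> R d} = nu.prob {d \<in> space \<nu>. d s = 0 \<and> R d}"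
    if j: "j \<in> {0, 1, 2}" for j
  proof -
    let ?U = "\<lambda>d. d(s := (d s + j) mod 3)"
    have "nu.prob {d \<in> space \<nu>. d s = j \<and> R d} = measure (distr \<nu> \<nu> ?U) {d \<in> space \<nu>. d s = j \<and> R d}"
      by (simp only: distr_rotate(2))
    also have "\<dots> = nu.prob (?U -` {d \<in> space \<nu>. d s = j \<and> R d} \<inter> space \<nu>)"
      by (rule measure_distr[OF distr_rotate(1)]) measurable
    also have "?U -` {d \<in> space \<nu>. d s = j \<and> R d} \<inter> space \<nu> = {d \<in> space \<nu>. d s = 0 \<and> R d}"
    proof (intro set_eqI)
      fix d
      have "(d s + j) mod 3 = j \<longleftrightarrow> d s = 0" if "d \<in> space \<nu>"
        using full_3_shift_digit[of d s] that j by (auto simp: space_full_3_shift_measure)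
      then show "d \<in> ?U -` {d \<in> space \<nu>. d s = j \<and> R d} \<inter> space \<nu> \<longleftrightarrow> d \<in> {d \<in> space \<nu>. d s = 0 \<and> R d}"
        using measurable_space[OF distr_rotate(1), of d s j] by (auto simp: indep)
    qed
    finally show ?thesis .
  qed
  have "{d \<in> space \<nu>. R d} = (\<Union>i\<in>{0, 1, 2}. {d \<in> space \<nu>. d s = i \<and> R d})"
    using full_3_shift_digit[of _ s] by (auto simp: space_full_3_shift_measure)
  also have "nu.prob \<dots> = (\<Sum>i\<in>{0, 1, 2}. nu.prob {d \<in> space \<nu>. d s = i \<and> R d})"
    by (rule nu.finite_measure_finite_Union) (auto simp: disjoint_family_on_def)
  also have "\<dots> = 3 * nu.prob {d \<in> space \<nu>. d s = j \<and> R d}"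
    using rotate[of 0] rotate[of 1] rotate[of 2] rotate[OF j] by simp
  finally show ?thesis by simp
qed

text \<open>The digit at \<open>s\<close> is independent of what happens at the children.  The probabilities that both and that at
  least one of two events occur add up to the sum of their probabilities, which yields
  the factor \<open>2/3\<close> per generation.\<close>

lemma prob_survives:
  assumes p: "p \<in> {0, 2}"
  shows "nu.prob {d \<in> space \<nu>. survives p n s d} = (2/3) ^ n"
proof (induction n arbitrary: s)
  case 0
  show ?case using nu.prob_space by simp
next
  case (Suc n)
  define Q where "Q c = survives p n (s + c)" for c
  have Q [measurable]: "Measurable.pred \<nu> (Q c)" for c unfolding Q_def by measurable
  have indep: "Q c (d(s := x)) = Q c d" if "c \<in> {gen_a, gen_b}" for c d x
    unfolding Q_def using that by (intro survives_cong) (auto simp: height_hom)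
  have IH: "nu.prob {d \<in> space \<nu>. Q c d} = (2/3) ^ n" for c
    unfolding Q_def by (rule Suc)
  have "{d \<in> space \<nu>. survives p (Suc n) s d} = {d \<in> space \<nu>. d s = 1 \<and> (Q gen_a d \<and> Q gen_b d)} \<union>
      {d \<in> space \<nu>. d s = p \<and> (Q gen_a d \<or> Q gen_b d)}"
    by (auto simp: Q_def)
  also have "nu.prob \<dots> = nu.prob {d \<in> space \<nu>. d s = 1 \<and> (Q gen_a d \<and> Q gen_b d)} +
      nu.prob {d \<in> space \<nu>. d s = p \<and> (Q gen_a d \<or> Q gen_b d)}"
    using p by (intro nu.finite_measure_Union) auto
  also have "nu.prob {d \<in> space \<nu>. d s = 1 \<and> (Q gen_a d \<and> Q gen_b d)} =
      nu.prob {d \<in> space \<nu>. Q gen_a d \<and> Q gen_b d} / 3"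
    by (rule prob_digit_independent) (simp_all add: indep)
  also have "nu.prob {d \<in> space \<nu>. d s = p \<and> (Q gen_a d \<or> Q gen_b d)} =
      nu.prob {d \<in> space \<nu>. Q gen_a d \<or> Q gen_b d} / 3"
    using p by (intro prob_digit_independent) (auto simp add: indep)
  also have "nu.prob {d \<in> space \<nu>. Q gen_a d \<or> Q gen_b d} =
      nu.prob ({d \<in> space \<nu>. Q gen_a d} \<union> {d \<in> space \<nu>. Q gen_b d})"
    by (rule arg_cong[of _ _ nu.prob]) blast
  also have "\<dots> = nu.prob {d \<in> space \<nu>. Q gen_a d} + nu.prob {d \<in> space \<nu>. Q gen_b d} -
      nu.prob ({d \<in> space \<nu>. Q gen_a d} \<inter> {d \<in> space \<nu>. Q gen_b d})"
    by (intro measure_Un3) (simp_all add: nu.fmeasurable_eq_sets)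
  also have "{d \<in> space \<nu>. Q gen_a d} \<inter> {d \<in> space \<nu>. Q gen_b d} = {d \<in> space \<nu>. Q gen_a d \<and> Q gen_b d}"
    by blast
  finally show ?case by (simp add: IH field_simps)
qed

lemma ambiguous_null: "ambiguous \<in> null_sets \<nu>"
proof -
  define N where "N p s = {d \<in> space \<nu>. \<forall>n. survives p n s d}" for p s
  have N_sets: "N p s \<in> sets \<nu>" for p s unfolding N_def by measurable
  have "N p s \<in> null_sets \<nu>" if p: "p \<in> {0, 2}" for p s
  proof -
    have "nu.prob (N p s) \<le> (2/3) ^ n" for n
      unfolding prob_survives[OF p, of n s, symmetric]
      by (rule nu.finite_measure_mono) (auto simp: N_def)
    moreover have "(\<lambda>n. (2/3 :: real) ^ n) \<longlonglongrightarrow> 0"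
      using power_two_thirds_tendsto_0[of 1] by simp
    ultimately have "nu.prob (N p s) \<le> 0"
      by (intro LIMSEQ_le_const) auto
    then have "nu.prob (N p s) = 0" using measure_nonneg[of \<nu> "N p s"] by simp
    then show ?thesis using N_sets by (simp add: nu.emeasure_eq_measure null_setsI)
  qed
  then have "(\<Union>s. N 2 s \<union> N 0 s) \<in> null_sets \<nu>"
    by (intro null_sets_UN null_sets.Un) auto
  moreover have "(\<Union>s. N 2 s \<union> N 0 s) = ambiguous"
    by (auto simp: N_def ambiguous_def space_full_3_shift_measure)
  ultimately show ?thesis by simp
qed

text \<open>If \<open>k\<close> attains \<open>2\<close>, the recursion forces \<open>k = 2\<close>, \<open>d = 2\<close> and \<open>d' = 0\<close> at all descendants.  Otherwise
  \<open>k \<le> 1\<close>, and \<open>k\<^sub>s = 1\<close> forces \<open>k\<^sub>s\<^sub>a + k\<^sub>s\<^sub>b = 3 - (d\<^sub>s - d'\<^sub>s)\<close>: at least one child carries a \<open>1\<close>, and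
  both do unless \<open>d\<^sub>s = 2\<close> and \<open>d'\<^sub>s = 0\<close>.\<close>

lemma survives_if_difference_positive:
  fixes k :: "free2 \<Rightarrow> int"
  assumes d: "d \<in> full_3_shift" and d': "d' \<in> full_3_shift"
    and rec: "\<And>s. 3 * k s = k (s + gen_a) + k (s + gen_b) + (d s - d' s)"
    and le: "\<And>s. k s \<le> 2" and pos: "1 \<le> k r"
  shows "\<exists>s. (\<forall>n. survives 2 n s d) \<and> (\<forall>n. survives 0 n s d')"
proof (cases "\<exists>s. k s = 2")
  case True
  then obtain s where s: "k s = 2" by blast
  have "k t = 2 \<Longrightarrow> survives 2 n t d \<and> survives 0 n t d'" for n t
  proof (induction n arbitrary: t)
    case (Suc n)
    have "k (t + gen_a) = 2 \<and> k (t + gen_b) = 2 \<and> d t = 2 \<and> d' t = 0"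
      using rec[of t] le[of "t + gen_a"] le[of "t + gen_b"] Suc.prems
        full_3_shift_bounds[OF d, of t] full_3_shift_bounds[OF d', of t] by presburger
    with Suc.IH show ?case by simp
  qed simp
  with s show ?thesis by blast
next
  case False
  then have le1: "k s \<le> 1" for s
  proof -
    have "k s \<noteq> 2" using False by blast
    then show ?thesis using le[of s] by linarith
  qed
  have "1 \<le> k t \<Longrightarrow> survives 2 n t d \<and> survives 0 n t d'" for n t
  proof (induction n arbitrary: t)
    case (Suc n)
    have digits: "d t \<in> {0, 1, 2}" "d' t \<in> {0, 1, 2}"
      by (rule full_3_shift_digit[OF d] full_3_shift_digit[OF d'])+
    define A where "A \<longleftrightarrow> 1 \<le> k (t + gen_a)"
    define B where "B \<longleftrightarrow> 1 \<le> k (t + gen_b)"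
    have "(d t = 1 \<and> A \<and> B \<or> d t = 2 \<and> (A \<or> B)) \<and> (d' t = 1 \<and> A \<and> B \<or> d' t = 0 \<and> (A \<or> B))"
      unfolding A_def B_def
      using rec[of t] le1[of "t + gen_a"] le1[of "t + gen_b"] Suc.prems
        full_3_shift_bounds[OF d, of t] full_3_shift_bounds[OF d', of t] by presburger
    with Suc.IH[of "t + gen_a"] Suc.IH[of "t + gen_b"] show ?case
      unfolding A_def B_def survives.simps by blast
  qed simp
  with pos show ?thesis by blast
qed

text \<open>A nonzero difference leaves its trace in both configurations, so it puts both of them in the exceptional
  set, which is therefore a union of fibres.\<close>

lemma homoclinic_fibre_trivial:
  assumes d: "d \<in> full_3_shift - ambiguous" and d': "d' \<in> full_3_shift"
    and eq: "homoclinic_map d = homoclinic_map d'"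
  shows "d = d'"
proof -
  have dY: "d \<in> full_3_shift" using d by blast
  have "\<exists>n. real_lift d s - real_lift d' s = of_int n" for s
  proof -
    have "real_lift d s - real_lift d' s \<in> \<int>"
      using fun_cong[OF eq, of s] by (simp only: homoclinic_map_eq circle_of_eq_iff)
    then show ?thesis by (auto elim: Ints_cases)
  qed
  then obtain k where k: "\<And>s. real_lift d s - real_lift d' s = of_int (k s)" by metis
  have rec: "3 * k s = k (s + gen_a) + k (s + gen_b) + (d s - d' s)" for s
  proof -
    have "real_of_int (3 * k s) = of_int (k (s + gen_a) + k (s + gen_b) + (d s - d' s))"
      using real_lift_recursion[OF dY, of s] real_lift_recursion[OF d', of s]
      unfolding of_int_add of_int_diff of_int_mult k[symmetric] by (simp add: algebra_simps)
    then show ?thesis by (simp only: of_int_eq_iff)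
  qed
  have bounds: "k s \<le> 2" "- k s \<le> 2" for s
  proof -
    have "real_of_int (k s) \<le> 2" "- real_of_int (k s) \<le> 2"
      using real_lift_bounds[OF dY, of s] real_lift_bounds[OF d', of s] unfolding k[symmetric] by linarith+
    then show "k s \<le> 2" "- k s \<le> 2" by linarith+
  qed
  have "k s = 0" for s
  proof (rule ccontr)
    assume "k s \<noteq> 0"
    then consider "1 \<le> k s" | "1 \<le> - k s" by linarith
    then show False
    proof cases
      case 1
      with survives_if_difference_positive[OF dY d' rec bounds(1)] d show False
        unfolding ambiguous_def by blast
    next
      case 2
      have "3 * - k s = - k (s + gen_a) + - k (s + gen_b) + (d' s - d s)" for s
        using rec[of s] by simp
      from survives_if_difference_positive[where k = "\<lambda>s. - k s", OF d' dY this bounds(2) 2] d show False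
        unfolding ambiguous_def by blast
    qed
  qed
  with rec show ?thesis by (simp add: fun_eq_iff)
qed

lemma closed_survives: "closed {d. survives p n s d}"
proof (induction n arbitrary: s)
  case 0
  have "survives p 0 s = (\<lambda>_. True)" by (simp add: fun_eq_iff)
  then show ?case by simp
next
  case (Suc n)
  have "closed {d :: free2 \<Rightarrow> int. d s = j}" for j
    using closed_vimage[OF closed_singleton[of j] continuous_on_product_coordinates[of s]]
    by (simp add: vimage_def)
  with Suc show ?case
    unfolding survives.simps by (intro closed_Collect_conj closed_Collect_disj)
qed

lemma survives_left_shift: "survives p n t (left_shift s d) = survives p n (- s + t) d"
  by (induction n arbitrary: t) (simp_all add: left_shift_def add.assoc)

lemma left_shift_unambiguous:
  assumes "d \<in> full_3_shift - ambiguous"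
  shows "left_shift s d \<in> full_3_shift - ambiguous"
  using assms left_shift_full_3_shift[of d s] by (auto simp: ambiguous_def survives_left_shift)

section \<open>The measurable isomorphism\<close>

lemma borel_image_ambiguous:
  "homoclinic_map ` ambiguous \<in> sets borel"
proof -
  define C where "C p s = {d. \<forall>n. survives p n s d}" for p s
  have "closed (C p s)" for p s
    unfolding C_def by (intro closed_Collect_all closed_survives)
  then have "homoclinic_map ` (full_3_shift \<inter> C p s) \<in> sets borel" for p s
    by (intro borel_closed closed_homoclinic_image)
  then have "(\<Union>s. homoclinic_map ` (full_3_shift \<inter> C 2 s) \<union> homoclinic_map ` (full_3_shift \<inter> C 0 s)) \<in> sets borel"
    by (intro sets.countable_UN' sets.Un) auto
  moreover have "(\<Union>s. homoclinic_map ` (full_3_shift \<inter> C 2 s) \<union> homoclinic_map ` (full_3_shift \<inter> C 0 s)) =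
      homoclinic_map ` ambiguous"
    unfolding ambiguous_def C_def by blast
  ultimately show ?thesis by (simp only:)
qed

abbreviation "unambiguous \<equiv> full_3_shift - ambiguous"

lemma inj_on_unambiguous: "inj_on homoclinic_map unambiguous"
  using homoclinic_fibre_trivial by (intro inj_onI) blast

lemma image_unambiguous:
  "homoclinic_map ` unambiguous = principal_space f_ab - homoclinic_map ` ambiguous"
proof -
  have sub: "ambiguous \<subseteq> full_3_shift" by (auto simp: ambiguous_def)
  have "homoclinic_map d \<noteq> homoclinic_map d'" if "d \<in> unambiguous" "d' \<in> ambiguous" for d d'
  proof
    assume "homoclinic_map d = homoclinic_map d'"
    moreover have "d' \<in> full_3_shift" using that(2) by (simp add: ambiguous_def)
    ultimately have "d = d'" using homoclinic_fibre_trivial[OF that(1)] by simp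
    with that show False by simp
  qed
  with sub show ?thesis
    unfolding homoclinic_map_surj[symmetric] by (auto intro!: imageI)
qed

text \<open>The preimage under the inverse of a closed set \<open>C\<close> is the trace of \<open>\<phi>(C)\<close>, because a fibre that meets the
  complement of the exceptional set is a single point, and \<open>\<phi>(C)\<close> is compact.\<close>

lemma measurable_inverse:
  assumes N: "sets N = sets (restrict_space borel (principal_space f_ab))"
  shows "the_inv_into unambiguous homoclinic_map \<in>
    restrict_space N (homoclinic_map ` unambiguous) \<rightarrow>\<^sub>M \<nu>"
proof (rule measurable_into_full_3_shift)
  let ?Img = "homoclinic_map ` unambiguous" and ?g = "the_inv_into unambiguous homoclinic_map"
  have "?Img \<subseteq> principal_space f_ab" using image_unambiguous by blast
  then have sp: "space (restrict_space N ?Img) = ?Img"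
    using sets_eq_imp_space_eq[OF N] by (auto simp: space_restrict_space)
  have inv: "?g (homoclinic_map d) = d" if "d \<in> unambiguous" for d
    by (rule the_inv_into_f_f[OF inj_on_unambiguous that])
  show "?g y \<in> full_3_shift" if "y \<in> space (restrict_space N ?Img)" for y
  proof -
    obtain d where "d \<in> unambiguous" "y = homoclinic_map d" using \<open>y \<in> _\<close> unfolding sp by blast
    then show ?thesis using inv[of d] by simp
  qed
  fix s
  show "(\<lambda>y. ?g y s) \<in> restrict_space N ?Img \<rightarrow>\<^sub>M count_space UNIV"
    unfolding measurable_count_space_eq2_countable
  proof (intro conjI ballI)
    fix i :: int
    let ?C = "homoclinic_map ` (full_3_shift \<inter> {d. d s = i})"
    have "closed {d :: free2 \<Rightarrow> int. d s = i}"
      using closed_vimage[OF closed_singleton[of i] continuous_on_product_coordinates[of s]]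
      by (simp add: vimage_def)
    then have "?C \<in> sets borel" by (intro borel_closed closed_homoclinic_image)
    moreover have "?C \<subseteq> principal_space f_ab" using homoclinic_map_in_principal_space by blast
    ultimately have C: "?C \<in> sets N" unfolding N by (auto simp: sets_restrict_space)
    have "(\<lambda>y. ?g y s) -` {i} \<inter> ?Img = ?Img \<inter> ?C"
    proof (intro set_eqI iffI)
      fix y assume "y \<in> (\<lambda>y. ?g y s) -` {i} \<inter> ?Img"
      then obtain d where d: "d \<in> unambiguous" "y = homoclinic_map d" "?g y s = i" by blast
      then have "d s = i" using inv[of d] by simp
      with d show "y \<in> ?Img \<inter> ?C" by blast
    next
      fix y assume "y \<in> ?Img \<inter> ?C"
      then obtain d d' where d: "d \<in> unambiguous" "y = homoclinic_map d"
        "d' \<in> full_3_shift" "d' s = i" "y = homoclinic_map d'" by blast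
      then have "d = d'" using homoclinic_fibre_trivial[of d d'] by simp
      then have "?g y s = i" using inv[OF d(1)] d(2,4) by simp
      then show "y \<in> (\<lambda>y. ?g y s) -` {i} \<inter> ?Img" using d(1,2) by simp
    qed
    with C show "(\<lambda>y. ?g y s) -` {i} \<inter> space (restrict_space N ?Img) \<in> sets (restrict_space N ?Img)"
      unfolding sp by (auto simp: sets_restrict_space)
  qed auto
qed

lemma homoclinic_map_equivariant:
  assumes "d \<in> full_3_shift"
  shows "homoclinic_map (left_shift s d) = principal_action f_ab s (homoclinic_map d)"
  using homoclinic_map_left_shift[OF assms] homoclinic_map_in_principal_space[OF assms]
  by (simp add: principal_action_def)

lemma distr_homoclinic_map:
  "homoclinic_map \<in> \<nu> \<rightarrow>\<^sub>M normalized_haar (principal_space f_ab)"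
  "distr \<nu> (normalized_haar (principal_space f_ab)) homoclinic_map = normalized_haar (principal_space f_ab)"
proof -
  have sets: "sets (normalized_haar (principal_space f_ab)) = sets (restrict_space borel (principal_space f_ab))"
    by (simp add: normalized_haar_eq_homoclinic_law)
  show "homoclinic_map \<in> \<nu> \<rightarrow>\<^sub>M normalized_haar (principal_space f_ab)"
    using measurable_homoclinic_map_principal_space by (simp add: measurable_cong_sets[OF refl sets])
  show "distr \<nu> (normalized_haar (principal_space f_ab)) homoclinic_map = normalized_haar (principal_space f_ab)"
    using distr_cong[OF refl sets, of \<nu> homoclinic_map homoclinic_map] by (simp add: normalized_haar_eq_homoclinic_law)
qed

lemma homoclinic_map_isomorphism:
  "measurable_isomorphism \<nu> left_shift (normalized_haar (principal_space f_ab)) (principal_action f_ab) homoclinic_map"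
  unfolding measurable_isomorphism_def
proof (intro conjI bexI[of _ "homoclinic_map ` unambiguous"] bexI[of _ unambiguous] distr_homoclinic_map)
  let ?H = "normalized_haar (principal_space f_ab)" and ?Img = "homoclinic_map ` unambiguous"
  have sN: "sets ?H = sets (restrict_space borel (principal_space f_ab))"
    by (simp add: normalized_haar_eq_homoclinic_law)
  have spN: "space ?H = principal_space f_ab"
    using sets_eq_imp_space_eq[OF sN] by (simp add: space_restrict_space)
  have "?Img = (UNIV - homoclinic_map ` ambiguous) \<inter> principal_space f_ab"
    unfolding image_unambiguous by blast
  moreover have "UNIV - homoclinic_map ` ambiguous \<in> sets borel"
    using borel_image_ambiguous by (intro sets.Diff) auto
  ultimately show N0: "?Img \<in> sets ?H" unfolding sN by (auto simp: sets_restrict_space)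
  show "unambiguous \<in> sets \<nu>"
    using ambiguous_null sets.top[of \<nu>] by (auto simp: space_full_3_shift_measure null_sets_def)
  show M0: "AE d in \<nu>. d \<in> unambiguous"
    using AE_not_in[OF ambiguous_null] AE_space by eventually_elim (simp add: space_full_3_shift_measure)
  have "AE d in \<nu>. homoclinic_map d \<in> ?Img" using M0 by eventually_elim blast
  then have "AE y in distr \<nu> ?H homoclinic_map. y \<in> ?Img"
    using N0 sets.sets_into_space[OF N0]
    by (subst AE_distr_iff[OF distr_homoclinic_map(1)]) (auto simp: Int_absorb1 Collect_conj_eq)
  then show "AE y in ?H. y \<in> ?Img" by (simp only: distr_homoclinic_map(2))
  show inv: "\<forall>g. \<forall>d\<in>unambiguous. left_shift g d \<in> unambiguous"
    using left_shift_unambiguous by blast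
  show equiv: "\<forall>g. \<forall>d\<in>unambiguous. homoclinic_map (left_shift g d) = principal_action f_ab g (homoclinic_map d)"
    using homoclinic_map_equivariant by blast
  show "\<forall>g. \<forall>y\<in>?Img. principal_action f_ab g y \<in> ?Img"
  proof (intro allI ballI)
    fix g y assume "y \<in> ?Img"
    then obtain d where d: "d \<in> unambiguous" "y = homoclinic_map d" by blast
    then have "principal_action f_ab g y = homoclinic_map (left_shift g d)" using equiv by metis
    with inv d(1) show "principal_action f_ab g y \<in> ?Img" by blast
  qed
  show "bij_betw homoclinic_map unambiguous ?Img"
    using inj_on_unambiguous by (rule inj_on_imp_bij_betw)
  show "the_inv_into unambiguous homoclinic_map \<in> restrict_space ?H ?Img \<rightarrow>\<^sub>M \<nu>"
    by (rule measurable_inverse[OF sN])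
qed

theorem theorem3p1:
  shows "(\<forall>d\<in>full_3_shift. \<forall>s.
             (\<lambda>t. int_scale (d t) (x_delta (- t + s))) summable_on UNIV) \<and>
         (\<forall>d\<in>full_3_shift. homoclinic_map d = rmul int_scale d x_delta) \<and>
         continuous_on full_3_shift homoclinic_map \<and>
         (\<forall>s. \<forall>d\<in>full_3_shift.
             homoclinic_map (left_shift s d) = principal_action f_ab s (homoclinic_map d)) \<and>
         homoclinic_map ` full_3_shift = principal_space f_ab \<and>
         (\<exists>E\<subseteq>full_3_shift. E \<in> null_sets full_3_shift_measure \<and>
             inj_on homoclinic_map (full_3_shift - E)) \<and>
         distr full_3_shift_measure (normalized_haar (principal_space f_ab)) homoclinic_map =
           normalized_haar (principal_space f_ab) \<and>
         measurable_isomorphism full_3_shift_measure left_shift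
           (normalized_haar (principal_space f_ab)) (principal_action f_ab) homoclinic_map"
proof (intro conjI exI[of _ ambiguous] ballI allI)
  show "(\<lambda>t. int_scale (d t) (x_delta (- t + s))) summable_on UNIV" if "d \<in> full_3_shift" for d s
    by (rule has_sum_imp_summable[OF has_sum_circle[OF that]])
  show "homoclinic_map d = rmul int_scale d x_delta" if "d \<in> full_3_shift" for d
    by (rule homoclinic_map_eq_rmul[OF that])
  show "homoclinic_map (left_shift s d) = principal_action f_ab s (homoclinic_map d)"
    if "d \<in> full_3_shift" for s d
    by (rule homoclinic_map_equivariant[OF that])
  show "ambiguous \<subseteq> full_3_shift" by (auto simp: ambiguous_def)
  show "ambiguous \<in> null_sets full_3_shift_measure" by (rule ambiguous_null)
  show "inj_on homoclinic_map (full_3_shift - ambiguous)" by (rule inj_on_unambiguous)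
  show "homoclinic_map ` full_3_shift = principal_space f_ab" by (rule homoclinic_map_surj)
qed (rule continuous_homoclinic_map distr_homoclinic_map(2) homoclinic_map_isomorphism)+

end
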